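(* Let $n\ge 3$, let $m\ge 0$ be an integer, let $f$ be a measurable function on $\mathbf{R}^{n-1}$ satisfying $$\int_{\mathbf{R}^{n-1}}\frac{|f(y')|}{1+|y'|^{n+m}}\,dy'<\infty ,$$ and let $$v(x)=\int_{\mathbf{R}^{n-1}}P_m(x,y')f(y')\,dy',\qquad x\in H .$$ Then there exists a set $E\subset H$ such that $E$ is minimally thin at infinity and $$\lim_{|x|\to\infty,\ x\in H\setminus E}\frac{v(x)}{x_n|x|^m}=0 .$$
   Context: Points of $\mathbf{R}^n$ are written $x=(x',x_n)$ with $x'\in\mathbf{R}^{n-1}$, $x_n\in\mathbf{R}$; $|\cdot|$ is the Euclidean norm and $x\cdot y$ the Euclidean inner product. $H=\{x\in\mathbf{R}^n: x_n>0\}$ is the upper half space, and $\partial H$ is identified with $\mathbf{R}^{n-1}$ via $y'\mapsto(y',0)$. $\omega_n=2\pi^{n/2}/\Gamma(n/2)$ is the surface area of the unit sphere in $\mathbf{R}^n$. For $\lambda>0$, the Gegenbauer (ultraspherical) polynomials $C_k^\lambda$ are defined by $(1-2tr+r^2)^{-\lambda}=\sum_{k=0}^\infty C_k^\lambda(t)r^k$ for $|r|<1$, $|t|\le1$. The Poisson kernel of $H$ is $P(x,y')=\dfrac{2x_n}{\omega_n|x-(y',0)|^n}$ for $x\in H$, $y'\in\mathbf{R}^{n-1}$. The modified Poisson kernel is $$P_m(x,y')=\begin{cases}P(x,y'), & |y'|\le 1,\\[4pt] P(x,y')-\displaystyle\sum_{k=0}^{m-1}\frac{2x_n|x|^k}{\omega_n|y'|^{n+k}}\,C_k^{n/2}\!\left(\frac{x\cdot(y',0)}{|x||y'|}\right),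 & |y'|>1,\end{cases}$$ where an empty sum is $0$. Minimal thinness. For a set $E\subset H$ and an open set $F\subset\mathbf{R}^{n-1}$ put $$C(E;F)=\inf\int_{\mathbf{R}^{n-1}}g(y')\,dy',$$ where the infimum is over all nonnegative measurable functions $g$ on $\mathbf{R}^{n-1}$ such that $g=0$ outside $F$ and $\int_{\mathbf{R}^{n-1}}\frac{g(y')}{|x-(y',0)|^n}\,dy'\ge1$ for all $x\in E$. A set $E\subset H$ is called minimally thin at infinity if $$\sum_{i=1}^\infty 2^{-in}C(E_i;F_i)<\infty,$$ where $E_i=\{x\in E: 2^i\le|x|<2^{i+1}\}$ and $F_i=\{x\in\mathbf{R}^{n-1}: 2^i<|x|<2^{i+3}\}$. *)

theory Defs
  imports "HOL-Analysis.Analysis"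
begin

text \<open>
  A point \<open>x = (x', x\<^sub>n)\<close> of $n$-space is an element of \<open>(real ^ 'd) \<times> real\<close>, where
  \<open>n = CARD('d) + 1\<close>.  The library norm and inner product on this product type are the
  Euclidean ones, and \<open>y'\<close> is identified with \<open>(y', 0)\<close>.
\<close>

type_synonym 'd point = "(real ^ 'd) \<times> real"

definition half_space :: "('d::finite) point set" where
  "half_space = {x. 0 < snd x}"

definition sphere_area :: "nat \<Rightarrow> real" where
  "sphere_area n = 2 * pi powr (real n / 2) / Gamma (real n / 2)"

text \<open>
  Gegenbauer polynomials, as functions of \<open>t\<close> with \<open>\<bar>t\<bar> \<le> 1\<close>.  For \<open>0 < l\<close> and such \<open>t\<close>
  the description is proper, see \<open>gegenbauer_sums\<close> and \<open>gegenbauer_unique\<close> below;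
  other arguments do not occur.
\<close>

definition gegenbauer :: "real \<Rightarrow> nat \<Rightarrow> real \<Rightarrow> real" where
  "gegenbauer l k t =
     (THE c. \<forall>r. \<bar>r\<bar> < 1 \<longrightarrow> (\<lambda>j. c j * r ^ j) sums ((1 - 2 * t * r + r\<^sup>2) powr (- l))) k"

definition poisson_kernel :: "('d::finite) point \<Rightarrow> real ^ 'd \<Rightarrow> real" where
  "poisson_kernel x y =
     (let n = CARD('d) + 1 in 2 * snd x / (sphere_area n * norm (x - (y, 0)) ^ n))"

definition modified_poisson_kernel :: "nat \<Rightarrow> ('d::finite) point \<Rightarrow> real ^ 'd \<Rightarrow> real" where
  "modified_poisson_kernel m x y =
     (let n = CARD('d) + 1 in
      if norm y \<le> 1 then poisson_kernel x y
      else poisson_kernel x y -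
        (\<Sum>k<m. 2 * snd x * norm x ^ k / (sphere_area n * norm y ^ (n + k)) *
                gegenbauer (real n / 2) k (inner x (y, 0) / (norm x * norm y))))"

text \<open>
  The admissible functions are real-valued and Lebesgue measurable; their integrals may be infinite.
\<close>

definition boundary_capacity :: "('d::finite) point set \<Rightarrow> (real ^ 'd) set \<Rightarrow> ennreal" where
  "boundary_capacity E F =
     (let n = CARD('d) + 1 in
      INF g \<in> {g :: real ^ 'd \<Rightarrow> real.
                 g \<in> borel_measurable lebesgue \<and> (\<forall>y. 0 \<le> g y) \<and> (\<forall>y. y \<notin> F \<longrightarrow> g y = 0) \<and>
                 (\<forall>x\<in>E. 1 \<le> (\<integral>\<^sup>+ y. ennreal (g y / norm (x - (y, 0)) ^ n) \<partial>lebesgue))}.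
        \<integral>\<^sup>+ y. ennreal (g y) \<partial>lebesgue)"

text \<open>The series starts at index 1, hence the shift by \<open>Suc\<close>.\<close>

definition minimally_thin_at_infinity :: "('d::finite) point set \<Rightarrow> bool" where
  "minimally_thin_at_infinity E \<longleftrightarrow>
     (let n = CARD('d) + 1;
          shell = (\<lambda>i. {x \<in> E. 2 ^ i \<le> norm x \<and> norm x < 2 ^ (i + 1)});
          annulus = (\<lambda>i. {y :: real ^ 'd. 2 ^ i < norm y \<and> norm y < 2 ^ (i + 3)})
      in (\<Sum>i. ennreal (1 / 2 ^ (Suc i * n)) *
                boundary_capacity (shell (Suc i)) (annulus (Suc i))) < \<infinity>)"

lemma powser_sums_zero_imp_coeff_zero:
  fixes d :: "nat \<Rightarrow> real"
  assumes "\<And>r. r \<noteq> 0 \<Longrightarrow> \<bar>r\<bar> < 1 \<Longrightarrow> (\<lambda>j. d j * r ^ j) sums 0"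
  shows "d k = 0"
  using assms
proof (induction k arbitrary: d)
  case (0 d)
  have "((\<lambda>_. 0) \<longlongrightarrow> d 0) (at (0::real))"
    by (rule powser_limit_0_strong[where s = 1]) (use 0 in auto)
  then show ?case
    using LIM_unique tendsto_const by blast
next
  case (Suc k d)
  have "((\<lambda>_. 0) \<longlongrightarrow> d 0) (at (0::real))"
    by (rule powser_limit_0_strong[where s = 1]) (use Suc.prems in auto)
  then have d0: "d 0 = 0"
    using LIM_unique tendsto_const by blast
  have "(\<lambda>j. d (Suc j) * r ^ j) sums 0" if r: "r \<noteq> 0" "\<bar>r\<bar> < 1" for r
  proof -
    have "(\<lambda>j. d (Suc j) * r ^ Suc j) sums 0"
      using Suc.prems[OF r] d0 by (subst sums_Suc_iff) simp
    from sums_mult[OF this, of "1 / r"] show ?thesis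
      using r by (simp add: field_simps)
  qed
  from Suc.IH[OF this] show ?case by simp
qed

lemma gegenbauer_series_exists:
  assumes "\<bar>t\<bar> \<le> 1"
  shows "\<exists>c :: nat \<Rightarrow> real. \<forall>r. \<bar>r\<bar> < 1 \<longrightarrow>
           (\<lambda>j. c j * r ^ j) sums ((1 - 2 * t * r + r\<^sup>2) powr (- l))"
proof -
  define z where "z = cis (arccos t)"
  have rez: "Re z = t" using assms by (simp add: z_def)
  have nz: "norm z = 1" by (simp add: z_def)
  define a where "a j = (complex_of_real (- l) gchoose j) * (- z) ^ j" for j
  define b where "b j = (complex_of_real (- l) gchoose j) * (- cnj z) ^ j" for j
  define c where "c k = (\<Sum>i\<le>k. a i * b (k - i))" for k
  have bin: "(\<lambda>j. ((complex_of_real (- l) gchoose j) * (- w) ^ j) * of_real r ^ j)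
               sums ((1 - of_real r * w) powr of_real (- l))"
    if "norm w = 1" "\<bar>r\<bar> < 1" for w r
  proof -
    have "norm (- (of_real r * w)) < 1" using that by (simp add: norm_mult)
    from gen_binomial_complex[OF this, of "of_real (- l)"]
    have "(\<lambda>j. (complex_of_real (- l) gchoose j) * (- (of_real r * w)) ^ j)
            sums ((1 - of_real r * w) powr of_real (- l))"
      by (simp only: diff_conv_add_uminus)
    moreover have "(- (of_real r * w)) ^ j = (- w) ^ j * of_real r ^ j" for j
      unfolding power_mult_distrib[symmetric] by (simp add: mult.commute)
    ultimately show ?thesis by (simp only: mult.assoc)
  qed
  have abs: "summable (\<lambda>j. norm (((complex_of_real (- l) gchoose j) * (- w) ^ j) * of_real r ^ j))"
    if w: "norm w = 1" and r: "\<bar>r\<bar> < 1" for w r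
  proof -
    obtain s where s: "\<bar>r\<bar> < s" "s < 1" using r dense by blast
    then have "\<bar>s\<bar> < 1" by simp
    from sums_summable[OF bin[OF w this]] show ?thesis
      by (rule powser_insidea) (use s in simp)
  qed
  have "(\<lambda>j. Re (c j) * r ^ j) sums ((1 - 2 * t * r + r\<^sup>2) powr (- l))" if r: "\<bar>r\<bar> < 1" for r
  proof -
    define u where "u = 1 - of_real r * z"
    have lt: "norm (of_real r * z) < 1" using r nz by (simp add: norm_mult)
    have reu: "Re u > 0"
      using abs_Re_le_cmod[of "of_real r * z"] lt by (simp add: u_def)
    have nu: "norm u ^ 2 = 1 - 2 * t * r + r\<^sup>2"
    proof -
      have *: "t\<^sup>2 + (Im z)\<^sup>2 = 1" using nz rez by (simp add: cmod_def)
      have "norm u ^ 2 = 1 - 2 * t * r + r\<^sup>2 * (t\<^sup>2 + (Im z)\<^sup>2)"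
        unfolding cmod_power2 u_def
        by (simp add: rez power2_eq_square algebra_simps)
      then show ?thesis by (simp only: * mult_1_right)
    qed
    have cu: "1 - of_real r * cnj z = cnj u" by (simp add: u_def)
    have sa: "(\<lambda>j. a j * of_real r ^ j) sums (u powr of_real (- l))"
      using bin[OF nz r] by (simp add: a_def u_def)
    have sb: "(\<lambda>j. b j * of_real r ^ j) sums (cnj u powr of_real (- l))"
      using bin[of "cnj z", OF _ r] nz by (simp add: b_def flip: cu)
    have "(\<lambda>k. \<Sum>i\<le>k. (a i * of_real r ^ i) * (b (k - i) * of_real r ^ (k - i)))
            sums ((\<Sum>k. a k * of_real r ^ k) * (\<Sum>k. b k * of_real r ^ k))"
      by (rule Cauchy_product_sums)
         (use abs[OF nz r] abs[of "cnj z", OF _ r] nz in \<open>simp_all add: a_def b_def\<close>)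
    also have "(\<Sum>k. a k * of_real r ^ k) * (\<Sum>k. b k * of_real r ^ k) =
                 u powr of_real (- l) * cnj u powr of_real (- l)"
      using sa sb by (simp add: sums_iff)
    also have "cnj u powr of_real (- l) = cnj (u powr of_real (- l))"
      using reu by (subst cnj_powr) auto
    also have "u powr of_real (- l) * cnj (u powr of_real (- l)) =
                 of_real ((norm (u powr of_real (- l)))\<^sup>2)"
      by (rule complex_norm_square[symmetric])
    also have "norm (u powr of_real (- l)) = norm u powr (- l)"
      by (subst norm_powr_real_powr') auto
    also have "(norm u powr (- l))\<^sup>2 = (norm u ^ 2) powr (- l)"
      by (simp add: power2_eq_square powr_mult)
    also note nu
    also have "(\<lambda>k. \<Sum>i\<le>k. (a i * of_real r ^ i) * (b (k - i) * of_real r ^ (k - i))) =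
                 (\<lambda>k. c k * of_real r ^ k)"
    proof
      fix k
      have "(a i * of_real r ^ i) * (b (k - i) * of_real r ^ (k - i)) =
              a i * b (k - i) * of_real r ^ k" if "i \<le> k" for i
      proof -
        have "of_real r ^ k = (of_real r ^ i * of_real r ^ (k - i) :: complex)"
          using that by (simp flip: power_add)
        then show ?thesis by (simp add: mult_ac)
      qed
      then show "(\<Sum>i\<le>k. (a i * of_real r ^ i) * (b (k - i) * of_real r ^ (k - i))) =
                   c k * of_real r ^ k"
        unfolding c_def sum_distrib_right by (intro sum.cong refl) simp
    qed
    finally have "(\<lambda>k. Re (c k * of_real r ^ k)) sums
                    Re (of_real ((1 - 2 * t * r + r\<^sup>2) powr (- l)))"
      by (rule sums_Re)
    then show ?thesis by (simp flip: of_real_power)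
  qed
  then show ?thesis by (intro exI[where x = "\<lambda>j. Re (c j)"] allI impI)
qed

lemma gegenbauer_series_unique:
  assumes c: "\<forall>r. \<bar>r\<bar> < 1 \<longrightarrow> (\<lambda>j. c j * r ^ j) sums ((1 - 2 * t * r + r\<^sup>2) powr (- l))"
    and d: "\<forall>r. \<bar>r\<bar> < 1 \<longrightarrow> (\<lambda>j. d j * r ^ j) sums ((1 - 2 * t * r + r\<^sup>2) powr (- l))"
  shows "c = (d :: nat \<Rightarrow> real)"
proof
  fix k
  have "(\<lambda>j. (c j - d j) * r ^ j) sums 0" if "\<bar>r\<bar> < 1" for r
    using sums_diff[OF c[rule_format, OF that] d[rule_format, OF that]]
    by (simp add: algebra_simps)
  then show "c k = d k"
    using powser_sums_zero_imp_coeff_zero[of "\<lambda>j. c j - d j" k] by simp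
qed

lemma gegenbauer_sums:
  assumes "\<bar>t\<bar> \<le> 1" "\<bar>r\<bar> < 1"
  shows "(\<lambda>k. gegenbauer l k t * r ^ k) sums ((1 - 2 * t * r + r\<^sup>2) powr (- l))"
proof -
  obtain c :: "nat \<Rightarrow> real" where c: "\<forall>r. \<bar>r\<bar> < 1 \<longrightarrow>
      (\<lambda>j. c j * r ^ j) sums ((1 - 2 * t * r + r\<^sup>2) powr (- l))"
    using gegenbauer_series_exists[OF assms(1)] by blast
  have "(THE c. \<forall>r. \<bar>r\<bar> < 1 \<longrightarrow>
      (\<lambda>j. c j * r ^ j) sums ((1 - 2 * t * r + r\<^sup>2) powr (- l))) = c"
    by (rule the_equality, rule c) (rule gegenbauer_series_unique[OF _ c])
  then have "gegenbauer l k t = c k" for k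
    by (simp add: gegenbauer_def)
  then show ?thesis using c assms(2) by simp
qed

lemma gegenbauer_unique:
  assumes "\<bar>t\<bar> \<le> 1"
    and "\<And>r. \<bar>r\<bar> < 1 \<Longrightarrow> (\<lambda>j. c j * r ^ j) sums ((1 - 2 * t * r + r\<^sup>2) powr (- l))"
  shows "gegenbauer l k t = c k"
proof -
  have "(\<lambda>k. gegenbauer l k t) = c"
    by (rule gegenbauer_series_unique[of _ t l]) (use assms gegenbauer_sums in auto)
  then show ?thesis by (rule fun_cong)
qed

end

theory Submission
  imports Defs
begin

text \<open>
  Fix \<open>x\<close> in the dyadic shell \<open>2\<^sup>j\<^sup>+\<^sup>1 \<le> \<bar>x\<bar> < 2\<^sup>j\<^sup>+\<^sup>2\<close> and put
  \<open>h(y) = \<bar>f(y)\<bar> / (1 + \<bar>y\<bar>\<^sup>n\<^sup>+\<^sup>m)\<close>, an integrable function.  The generating function expands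
  the Poisson kernel in powers of \<open>\<bar>x\<bar> / \<bar>y\<bar>\<close>, and the modified kernel is what remains after the
  first \<open>m\<close> terms are removed.  For \<open>\<bar>y\<bar>\<close> large compared with \<open>\<bar>x\<bar>\<close> it is therefore
  \<open>O(x\<^sub>n \<bar>x\<bar>\<^sup>m / \<bar>y\<bar>\<^sup>n\<^sup>+\<^sup>m)\<close>, while for the remaining \<open>y\<close> the Poisson kernel and the
  subtracted polynomial are estimated separately.  The outcome (\<open>modified_poisson_kernel_bound\<close>)
  is that, up to a constant, the modified kernel is at most \<open>x\<^sub>n\<close> times
  \<open>1\<^sub>A(y) / \<bar>x - y\<bar>\<^sup>n + \<bar>x\<bar>\<^sup>m min(1, (1 + \<bar>y\<bar>) / 2\<^sup>j) / (1 + \<bar>y\<bar>\<^sup>n\<^sup>+\<^sup>m)\<close>,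
  where \<open>A = A\<^sub>j = {2\<^sup>j < \<bar>y\<bar> < 2\<^sup>j\<^sup>+\<^sup>4}\<close>.
  The second term contributes \<open>\<integral> h min(1, (1 + \<bar>y\<bar>) / 2\<^sup>j)\<close> to \<open>v(x) / (x\<^sub>n \<bar>x\<bar>\<^sup>m)\<close>, which
  tends to \<open>0\<close> by dominated convergence.  Only the first term, the potential of \<open>\<bar>f\<bar>\<close> restricted
  to \<open>A\<^sub>j\<close>, can be large, and at large \<open>x\<close> the set \<open>E\<close> is where it reaches \<open>\<epsilon>\<^sub>j \<bar>x\<bar>\<^sup>m\<close>.

  On that set \<open>\<bar>f\<bar>\<close> itself, divided by \<open>\<epsilon>\<^sub>j 2\<^bsup>jm\<^esup>\<close>, is almost a competitor for the capacity,
  so the \<open>j\<close>-th term of the thinness series is at most a constant times \<open>a\<^sub>j / \<epsilon>\<^sub>j\<close> with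
  \<open>a\<^sub>j = \<integral> h\<close> over \<open>A\<^sub>j\<close>.  Since \<open>\<Sum> a\<^sub>j\<close> converges, \<open>\<epsilon>\<^sub>j \<rightarrow> 0\<close> can be chosen so slowly that
  \<open>\<Sum> a\<^sub>j / \<epsilon>\<^sub>j\<close> still converges (\<open>summable_divide_sqrt_tail\<close>).

  One difficulty remains: a competitor must vanish off \<open>F = {\<rho> < \<bar>y\<bar> < 8\<rho>}\<close>, where \<open>\<rho> = 2\<^sup>j\<^sup>+\<^sup>1\<close>
  is the inner radius of the shell, whereas mass of \<open>\<bar>f\<bar>\<close> just inside the sphere \<open>\<bar>y\<bar> = \<rho>\<close>
  can be as close to \<open>x\<close> as one likes.  That mass is moved across the sphere by the inversion
  \<open>y \<mapsto> \<rho>\<^sup>2 y / \<bar>y\<bar>\<^sup>2\<close>.  Seen from a point with \<open>\<bar>x\<bar> \<ge> \<rho>\<close>, inversion increases distances at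
  most by the factor \<open>\<rho> / \<bar>y\<bar> \<le> 2\<close> (\<open>norm_diff_inversion_le\<close>), so the potential loses at most a
  factor \<open>2\<^sup>n\<close>.  The image measure has a density by the Radon--Nikodym theorem, because the
  inversion maps null sets to null sets (\<open>sweep_mass_out_of_ball\<close>).
\<close>

section \<open>Uniform bounds for Gegenbauer polynomials\<close>

lemma binomial_series_disc:
  fixes w :: complex
  assumes w: "norm w \<le> 1" and r: "\<bar>r\<bar> < 1"
  shows "(\<lambda>j. ((- of_real l) gchoose j) * (- w) ^ j * of_real r ^ j)
           sums ((1 - of_real r * w) powr (- of_real l))"
proof -
  have "\<bar>r\<bar> * norm w \<le> \<bar>r\<bar> * 1"
    by (intro mult_left_mono w) auto
  then have "norm (- (of_real r * w)) < 1"
    using r by (simp add: norm_mult)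
  from gen_binomial_complex[OF this, of "- of_real l"] show ?thesis
    by (simp add: power_mult_distrib power_minus[of "_ * _"] power_minus[of w] mult_ac)
qed

text \<open>
  A bound on the Gegenbauer polynomials that is uniform in \<open>t\<close> and summable against \<open>2\<^sup>-\<^sup>k\<close>
  makes all later estimates of the expansion uniform in the angle between \<open>x\<close> and \<open>y\<close>.
\<close>

lemma gegenbauer_dominated:
  fixes l :: real
  obtains D :: "nat \<Rightarrow> real" where
    "\<And>k. 0 \<le> D k" "summable (\<lambda>k. D k * (1/2) ^ k)"
    "\<And>t k. \<bar>t\<bar> \<le> 1 \<Longrightarrow> \<bar>gegenbauer l k t\<bar> \<le> D k"
proof
  \<comment> \<open>With \<open>t = cos \<theta>\<close> the generating function factors into two binomial series in
    \<open>exp (\<plusminus> i \<theta>) r\<close>; \<open>D\<close> is their Cauchy product with all coefficients replaced by moduli.\<close>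
  define \<beta> where "\<beta> j = (- complex_of_real l) gchoose j" for j
  define D where "D k = (\<Sum>i\<le>k. norm (\<beta> i) * norm (\<beta> (k - i)))" for k
  have abs: "summable (\<lambda>j. norm (\<beta> j * (- w) ^ j * of_real r ^ j))"
    if w: "norm w = 1" and r: "\<bar>r\<bar> < 1" for w r
  proof -
    obtain s where s: "\<bar>r\<bar> < s" "s < 1" using r dense by blast
    from binomial_series_disc[of w s l] s w
    have "summable (\<lambda>j. (\<beta> j * (- w) ^ j) * of_real s ^ j)"
      by (auto simp: \<beta>_def sums_iff)
    then show ?thesis
      by (rule powser_insidea) (use s in simp)
  qed
  show "0 \<le> D k" for k
    by (auto simp: D_def intro!: sum_nonneg)
  have "summable (\<lambda>j. norm (norm (\<beta> j) * (1/2) ^ j))"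
    using abs[of 1 "1/2"] by (simp add: norm_mult norm_power norm_divide)
  from summable_Cauchy_product[OF this this]
  have "summable (\<lambda>k. \<Sum>i\<le>k. (norm (\<beta> i) * (1/2) ^ i) * (norm (\<beta> (k - i)) * (1/2) ^ (k - i)))" .
  also have "(\<lambda>k. \<Sum>i\<le>k. (norm (\<beta> i) * (1/2) ^ i) * (norm (\<beta> (k - i)) * (1/2) ^ (k - i))) =
             (\<lambda>k. D k * (1/2) ^ k)"
    unfolding D_def sum_distrib_right
    by (intro ext sum.cong refl) (simp add: mult_ac flip: power_add)
  finally show "summable (\<lambda>k. D k * (1/2) ^ k)" .
  show "\<bar>gegenbauer l k t\<bar> \<le> D k" if t: "\<bar>t\<bar> \<le> 1" for t k
  proof -
    define z where "z = cis (arccos t)"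
    have nz: "norm z = 1" and rez: "Re z = t"
      using t by (simp_all add: z_def)
    define a b where "a j = \<beta> j * (- z) ^ j" and "b j = \<beta> j * (- cnj z) ^ j" for j
    define c where "c k = (\<Sum>i\<le>k. a i * b (k - i))" for k
    have "(\<lambda>j. Re (c j) * r ^ j) sums ((1 - 2 * t * r + r\<^sup>2) powr (- l))" if r: "\<bar>r\<bar> < 1" for r
    proof -
      define u where "u = 1 - of_real r * z"
      have "\<bar>r * t\<bar> < 1"
        using t r by (metis abs_mult abs_ge_zero mult_le_cancel_left1 mult_left_le order_le_less_trans)
      then have reu: "0 < Re u"
        using rez by (simp add: u_def)
      have z2: "t\<^sup>2 + (Im z)\<^sup>2 = 1"
        using nz rez by (simp add: cmod_def)
      have "(norm u)\<^sup>2 = 1 - 2 * t * r + r\<^sup>2 * (t\<^sup>2 + (Im z)\<^sup>2)"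
        unfolding cmod_power2 u_def by (simp add: rez power2_eq_square algebra_simps)
      then have nu: "(norm u)\<^sup>2 = 1 - 2 * t * r + r\<^sup>2"
        by (simp only: z2 mult_1_right)
      have sa: "(\<lambda>j. a j * of_real r ^ j) sums (u powr (- of_real l))"
        using binomial_series_disc[of z r l] nz r by (simp add: a_def \<beta>_def u_def)
      have sb: "(\<lambda>j. b j * of_real r ^ j) sums (cnj u powr (- of_real l))"
        using binomial_series_disc[of "cnj z" r l] nz r by (simp add: b_def \<beta>_def u_def)
      have "(\<lambda>k. \<Sum>i\<le>k. (a i * of_real r ^ i) * (b (k - i) * of_real r ^ (k - i)))
              sums (u powr (- of_real l) * cnj u powr (- of_real l))"
        using Cauchy_product_sums[of "\<lambda>i. a i * of_real r ^ i" "\<lambda>i. b i * of_real r ^ i"]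
          abs[of z r] abs[of "cnj z" r] nz r sa sb by (simp add: a_def b_def sums_iff)
      moreover have "(a i * of_real r ^ i) * (b (k - i) * of_real r ^ (k - i)) =
             a i * b (k - i) * of_real r ^ k" if "i \<le> k" for i k
        using that by (simp add: mult_ac flip: power_add)
      ultimately have "(\<lambda>k. c k * of_real r ^ k)
              sums (u powr (- of_real l) * cnj u powr (- of_real l))"
        by (simp add: c_def sum_distrib_right)
      also have "u powr (- of_real l) * cnj u powr (- of_real l) =
                   u powr (of_real (- l)) * cnj (u powr (of_real (- l)))"
        using reu by (subst cnj_powr) auto
      also have "\<dots> = of_real ((norm (u powr of_real (- l)))\<^sup>2)"
        by (rule complex_norm_square[symmetric])
      also have "norm (u powr of_real (- l)) = norm u powr (- l)"
        by (subst norm_powr_real_powr') auto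
      also have "(norm u powr (- l))\<^sup>2 = (1 - 2 * t * r + r\<^sup>2) powr (- l)"
        unfolding nu[symmetric] by (simp add: power2_eq_square powr_mult)
      finally show ?thesis
        by (auto dest!: sums_Re simp flip: of_real_power)
    qed
    then have "gegenbauer l k t = Re (c k)"
      using t by (intro gegenbauer_unique) auto
    also have "\<bar>Re (c k)\<bar> \<le> norm (c k)"
      by (rule abs_Re_le_cmod)
    also have "\<dots> \<le> (\<Sum>i\<le>k. norm (a i * b (k - i)))"
      unfolding c_def by (rule norm_sum)
    also have "\<dots> = D k"
      using nz by (simp add: D_def a_def b_def norm_mult norm_power)
    finally show ?thesis by simp
  qed
qed

text \<open>
  Removing the first \<open>m\<close> terms of a power series that converges up to \<open>r = 1/2\<close> leaves
  \<open>O(r\<^sup>m)\<close>: each factor \<open>r\<^sup>k\<^sup>+\<^sup>m\<close> is at most \<open>2\<^sup>-\<^sup>k r\<^sup>m\<close>.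
\<close>

lemma gegenbauer_tail_bound:
  fixes l :: real
  obtains A :: real where "0 \<le> A"
    "\<And>t k. \<bar>t\<bar> \<le> 1 \<Longrightarrow> k < m \<Longrightarrow> \<bar>gegenbauer l k t\<bar> \<le> A"
    "\<And>t r. \<bar>t\<bar> \<le> 1 \<Longrightarrow> 0 \<le> r \<Longrightarrow> r \<le> 1/2 \<Longrightarrow>
       \<bar>(1 - 2 * t * r + r\<^sup>2) powr (- l) - (\<Sum>k<m. gegenbauer l k t * r ^ k)\<bar> \<le> A * r ^ m"
proof -
  obtain D :: "nat \<Rightarrow> real" where D0: "\<And>k. 0 \<le> D k" and
    Ds: "summable (\<lambda>k. D k * (1/2) ^ k)" and
    DC: "\<And>t k. \<bar>t\<bar> \<le> 1 \<Longrightarrow> \<bar>gegenbauer l k t\<bar> \<le> D k"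
    using gegenbauer_dominated[of l] by blast
  define S where "S = (\<Sum>k. D k * (1/2) ^ k)"
  have S0: "0 \<le> S" unfolding S_def by (intro suminf_nonneg Ds) (simp add: D0)
  have DS: "D k \<le> 2 ^ k * S" for k
  proof -
    have "D k * (1/2) ^ k \<le> S"
      using sum_le_suminf[OF Ds, of "{k}"] D0 by (simp add: S_def)
    then show ?thesis by (simp add: field_simps)
  qed
  have "\<bar>gegenbauer l k t\<bar> \<le> 2 ^ m * S" if "\<bar>t\<bar> \<le> 1" "k < m" for t k
  proof -
    have "\<bar>gegenbauer l k t\<bar> \<le> 2 ^ k * S" using DC[OF that(1), of k] DS[of k] by simp
    also have "\<dots> \<le> 2 ^ m * S" using that S0 by (intro mult_right_mono power_increasing) auto
    finally show ?thesis .
  qed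
  moreover have "\<bar>(1 - 2 * t * r + r\<^sup>2) powr (- l) - (\<Sum>k<m. gegenbauer l k t * r ^ k)\<bar> \<le> 2 ^ m * S * r ^ m"
    if t: "\<bar>t\<bar> \<le> 1" and r: "0 \<le> r" "r \<le> 1/2" for t r
  proof -
    have tail: "(\<lambda>k. gegenbauer l (k + m) t * r ^ (k + m)) sums
       ((1 - 2 * t * r + r\<^sup>2) powr (- l) - (\<Sum>k<m. gegenbauer l k t * r ^ k))"
      using gegenbauer_sums[of t r l] t r by (intro sums_split_initial_segment) auto
    have Dm: "summable (\<lambda>k. D (k + m) * (1/2) ^ (k + m))"
      using Ds by (rule summable_ignore_initial_segment)
    have le: "\<bar>gegenbauer l (k + m) t * r ^ (k + m)\<bar> \<le> (2 * r) ^ m * (D (k + m) * (1/2) ^ (k + m))" for k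
    proof -
      have "\<bar>gegenbauer l (k + m) t * r ^ (k + m)\<bar> \<le> D (k + m) * (r ^ k * r ^ m)"
        using r DC[OF t, of "k + m"] by (simp add: abs_mult power_add mult_right_mono)
      also have "\<dots> \<le> D (k + m) * ((1/2) ^ k * r ^ m)"
        using r D0 by (intro mult_left_mono mult_right_mono power_mono) auto
      also have "\<dots> = (2 * r) ^ m * (D (k + m) * (1/2) ^ (k + m))"
        by (simp add: power_add power_mult_distrib power_one_over)
      finally show ?thesis .
    qed
    have sum: "summable (\<lambda>k. \<bar>gegenbauer l (k + m) t * r ^ (k + m)\<bar>)"
      by (rule summable_comparison_test[OF _ summable_mult[OF Dm, of "(2 * r) ^ m"]])
        (use le in auto)
    have "\<bar>(1 - 2 * t * r + r\<^sup>2) powr (- l) - (\<Sum>k<m. gegenbauer l k t * r ^ k)\<bar> \<le>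
        (\<Sum>k. \<bar>gegenbauer l (k + m) t * r ^ (k + m)\<bar>)"
      using summable_rabs[OF sum] tail by (simp add: sums_iff)
    also have "\<dots> \<le> (\<Sum>k. (2 * r) ^ m * (D (k + m) * (1/2) ^ (k + m)))"
      by (intro suminf_le le sum summable_mult Dm)
    also have "\<dots> = (2 * r) ^ m * (\<Sum>k. D (k + m) * (1/2) ^ (k + m))"
      by (rule suminf_mult[OF Dm])
    also have "\<dots> \<le> (2 * r) ^ m * S"
      unfolding S_def using suminf_split_initial_segment[OF Ds, of m] D0 r
      by (intro mult_left_mono) (simp_all add: sum_nonneg)
    finally show ?thesis by (simp add: power_mult_distrib mult_ac)
  qed
  ultimately show ?thesis using S0 by (intro that[of "2 ^ m * S"]) auto
qed

section \<open>Size of the modified Poisson kernel\<close>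

lemma sphere_area_pos: "0 < n \<Longrightarrow> 0 < sphere_area n"
  by (simp add: sphere_area_def Gamma_real_pos)

text \<open>
  The annulus reaches from half the inner radius of the shell \<open>2\<^sup>j\<^sup>+\<^sup>1 \<le> \<bar>x\<bar> < 2\<^sup>j\<^sup>+\<^sup>2\<close> to four times
  its outer radius.  Outside it, \<open>\<bar>x - y\<bar>\<close> is comparable with the larger of \<open>\<bar>x\<bar>\<close> and \<open>\<bar>y\<bar>\<close>.
\<close>

definition thick_annulus :: "nat \<Rightarrow> ('a::real_normed_vector) set" where
  "thick_annulus j = {y. 2 ^ j < norm y \<and> norm y < 2 ^ (j + 4)}"

text \<open>
  Bounding the kernel away from the annulus by \<open>x\<^sub>n \<bar>x\<bar>\<^sup>m / (1 + \<bar>y\<bar>\<^sup>n\<^sup>+\<^sup>m)\<close> alone would only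
  show that \<open>v(x) / (x\<^sub>n \<bar>x\<bar>\<^sup>m)\<close> is bounded there.  The cutoff records the additional gain for
  \<open>\<bar>y\<bar>\<close> small compared with \<open>2\<^sup>j\<close>, which turns boundedness into convergence to \<open>0\<close>.
\<close>

definition cutoff :: "nat \<Rightarrow> ('a::real_normed_vector) \<Rightarrow> real" where
  "cutoff j y = min 1 ((1 + norm y) / 2 ^ j)"

lemma cutoff_nonneg: "0 \<le> cutoff j y" and cutoff_le_1: "cutoff j y \<le> 1"
  by (auto simp: cutoff_def)

text \<open>
  Used when \<open>y\<close> is close to the origin, where \<open>\<bar>x - y\<bar>\<close> is comparable with \<open>R = \<bar>x\<bar>\<close>.  The ratio
  \<open>max(1, \<bar>y\<bar>) / R\<close> is at most \<open>1\<close>, so one of its \<open>N\<close> factors may be kept and the others dropped.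
\<close>

lemma inverse_power_le_cutoff:
  assumes R: "2 ^ j \<le> R" and y: "norm y \<le> R" and N: "0 < N" and R1: "1 \<le> R"
  shows "1 / R ^ N \<le> 2 * cutoff j y / (1 + norm y ^ N)"
proof -
  define u where "u = max 1 (norm y) / R"
  have u: "0 \<le> u" "u \<le> 1" using R1 y by (auto simp: u_def)
  have "max 1 (norm y) / R \<le> (1 + norm y) / 2 ^ j"
    by (intro frac_le R) auto
  then have uw: "u \<le> cutoff j y" using u by (simp add: cutoff_def u_def)
  have "1 \<le> max 1 (norm y) ^ N" "norm y ^ N \<le> max 1 (norm y) ^ N"
    by (auto intro!: one_le_power power_mono)
  then have "1 + norm y ^ N \<le> 2 * max 1 (norm y) ^ N"
    by linarith
  then have "(1 + norm y ^ N) / R ^ N \<le> 2 * u ^ N"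
    using R1 by (simp add: u_def power_divide divide_right_mono)
  also have "\<dots> \<le> 2 * u"
    using power_decreasing[of 1 N u] u N by simp
  finally have "(1 + norm y ^ N) / R ^ N \<le> 2 * cutoff j y" using uw by simp
  moreover have "0 < 1 + norm y ^ N" by (simp add: add_pos_nonneg)
  ultimately show ?thesis using R1 by (simp add: field_simps)
qed

text \<open>
  The link between the Poisson kernel and the Gegenbauer polynomials: by the law of cosines
  \<open>\<bar>x - y\<bar>\<^sup>2 = \<bar>y\<bar>\<^sup>2 (1 - 2tr + r\<^sup>2)\<close>.
\<close>

lemma distance_power_conv_generating_function:
  fixes x :: "'d::finite point" and y :: "real ^ 'd"
  assumes y: "y \<noteq> 0" and x: "0 < snd x"
  defines "t \<equiv> inner x (y, 0) / (norm x * norm y)" and "r \<equiv> norm x / norm y"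
  shows "\<bar>t\<bar> \<le> 1"
    and "1 / norm (x - (y, 0)) ^ n = (1 - 2 * t * r + r\<^sup>2) powr (- (real n / 2)) / norm y ^ n"
proof -
  have x0: "x \<noteq> 0" using x by auto
  show "\<bar>t\<bar> \<le> 1"
    using Cauchy_Schwarz_ineq2[of x "(y, 0)"] x0 y by (simp add: t_def abs_mult)
  define q where "q = 1 - 2 * t * r + r\<^sup>2"
  have "(norm (x - (y, 0)))\<^sup>2 = (norm x)\<^sup>2 - 2 * inner x (y, 0) + (norm (y, 0::real))\<^sup>2"
    by (simp only: power2_norm_eq_inner inner_diff_left inner_diff_right) (simp add: inner_commute)
  also have "\<dots> = (norm y)\<^sup>2 * q"
    using x0 y by (simp add: q_def t_def r_def field_simps power2_eq_square)
  finally have sq: "(norm (x - (y, 0)))\<^sup>2 = (norm y)\<^sup>2 * q" .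
  have pos: "0 < norm (x - (y, 0))" using x by (cases x) (auto simp: zero_prod_def)
  have q: "0 < q"
    using sq pos by (metis zero_less_mult_pos zero_less_power y zero_less_norm_iff)
  have "norm (x - (y, 0)) = norm y * sqrt q"
    using sq by (metis norm_ge_zero real_sqrt_mult real_sqrt_abs abs_of_nonneg)
  then have "norm (x - (y, 0)) ^ n = norm y ^ n * q powr (real n / 2)"
    using q by (simp add: power_mult_distrib powr_half_sqrt[symmetric] powr_powr flip: powr_realpow)
  then show "1 / norm (x - (y, 0)) ^ n = (1 - 2 * t * r + r\<^sup>2) powr (- (real n / 2)) / norm y ^ n"
    by (simp add: q_def powr_minus field_simps)
qed

text \<open>
  There are three regimes.  For \<open>\<bar>y\<bar> \<ge> 2\<^sup>j\<^sup>+\<^sup>4\<close> the ratio \<open>r = \<bar>x\<bar> / \<bar>y\<bar>\<close> is below \<open>1/2\<close> and the tail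
  bound of the expansion applies.  For smaller \<open>y\<close> the subtracted terms are
  \<open>\<bar>x\<bar>\<^sup>k / \<bar>y\<bar>\<^sup>n\<^sup>+\<^sup>k = (\<bar>x\<bar>\<^sup>m / \<bar>y\<bar>\<^sup>n\<^sup>+\<^sup>m) (\<bar>y\<bar> / \<bar>x\<bar>)\<^sup>m\<^sup>-\<^sup>k\<close> with \<open>m - k \<ge> 1\<close>, which is where the cutoff factor
  comes from.  The Poisson kernel itself is kept on the annulus and is of order \<open>x\<^sub>n \<bar>x\<bar>\<^sup>-\<^sup>n\<close> for \<open>y\<close>
  inside it.
\<close>

lemma modified_poisson_kernel_bound:
  obtains C where "0 \<le> C"
    "\<And>(x :: ('d::finite) point) y j. 0 < snd x \<Longrightarrow> 2 ^ (j + 1) \<le> norm x \<Longrightarrow> norm x < 2 ^ (j + 2) \<Longrightarrow>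
       \<bar>modified_poisson_kernel m x y\<bar> \<le> 2 * snd x / sphere_area (CARD('d) + 1) *
         (indicator (thick_annulus j) y / norm (x - (y, 0)) ^ (CARD('d) + 1) +
          C * norm x ^ m * (cutoff j y / (1 + norm y ^ (CARD('d) + 1 + m))))"
proof -
  define n where "n = CARD('d) + 1"
  define N where "N = n + m"
  obtain A where A0: "0 \<le> A" and
    AC: "\<And>t k. \<bar>t\<bar> \<le> 1 \<Longrightarrow> k < m \<Longrightarrow> \<bar>gegenbauer (real n / 2) k t\<bar> \<le> A" and
    Atail: "\<And>t r. \<bar>t\<bar> \<le> 1 \<Longrightarrow> 0 \<le> r \<Longrightarrow> r \<le> 1/2 \<Longrightarrow>
       \<bar>(1 - 2 * t * r + r\<^sup>2) powr (- (real n / 2)) - (\<Sum>k<m. gegenbauer (real n / 2) k t * r ^ k)\<bar> \<le> A * r ^ m"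
    using gegenbauer_tail_bound[of m "real n / 2"] by blast
  \<comment> \<open>The summands belong to large \<open>y\<close>, to the subtracted polynomial, and to the Poisson
    kernel near the origin, in this order.\<close>
  define C where "C = 2 * A + 2 * real m * A * 16 ^ m + 2 * 2 ^ n"
  have "\<bar>modified_poisson_kernel m x y\<bar> \<le> 2 * snd x / sphere_area n *
         (indicator (thick_annulus j) y / norm (x - (y, 0)) ^ n +
          C * norm x ^ m * (cutoff j y / (1 + norm y ^ N)))"
    if xpos: "0 < snd x" and j: "2 ^ (j + 1) \<le> norm x" "norm x < 2 ^ (j + 2)"
    for x :: "'d point" and y j
  proof -
    define c where "c = 2 * snd x / sphere_area n"
    have c: "0 < c" using xpos sphere_area_pos[of n] by (simp add: c_def n_def)
    define R s w where "R = norm x" and "s = norm y" and "w = cutoff j y"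
    have s0: "0 \<le> s" by (simp add: s_def)
    have w: "0 \<le> w" "w \<le> 1" by (simp_all add: w_def cutoff_nonneg cutoff_le_1)
    have j1: "(1::real) \<le> 2 ^ j" by simp
    have Rj: "2 * 2 ^ j \<le> R" "R < 4 * 2 ^ j" using j by (simp_all add: R_def)
    then have R: "1 \<le> R" using j1 by linarith
    define t r where "t = inner x (y, 0) / (norm x * norm y)" and "r = norm x / norm y"
    have s_one: "1 / s ^ N \<le> 2 / (1 + s ^ N)" if "1 \<le> s"
    proof -
      have "1 \<le> s ^ N" using that by (rule one_le_power)
      then have "0 < s ^ N" "0 < 1 + s ^ N" "1 \<le> s ^ N" by auto
      then show ?thesis by (simp add: divide_simps)
    qed
    have frac: "R ^ k / s ^ (n + k) = 1 / s ^ n * r ^ k" for k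
      by (simp add: r_def R_def s_def power_add power_divide)
    have PK: "poisson_kernel x y = c * (1 / norm (x - (y, 0)) ^ n)"
      by (simp add: poisson_kernel_def n_def c_def)
    have MPK: "modified_poisson_kernel m x y =
        c * (1 / norm (x - (y, 0)) ^ n - 1 / s ^ n * (\<Sum>k<m. gegenbauer (real n / 2) k t * r ^ k))"
      if "1 < s"
    proof -
      have "modified_poisson_kernel m x y = poisson_kernel x y -
          (\<Sum>k<m. c * (R ^ k / s ^ (n + k)) * gegenbauer (real n / 2) k t)"
        using that unfolding modified_poisson_kernel_def Let_def n_def[symmetric]
        by (simp add: c_def R_def s_def t_def)
      also have "\<dots> = poisson_kernel x y - c * (1 / s ^ n * (\<Sum>k<m. gegenbauer (real n / 2) k t * r ^ k))"
        by (simp add: frac sum_distrib_left mult_ac)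
      finally show ?thesis by (simp only: PK right_diff_distrib)
    qed
    have "\<bar>modified_poisson_kernel m x y\<bar> \<le> c * (indicator (thick_annulus j) y / norm (x - (y, 0)) ^ n +
          C * R ^ m * (w / (1 + s ^ N)))"
    proof (cases "s < 2 ^ (j + 4)")
      case False
      then have sj: "16 * 2 ^ j \<le> s" by (simp add: power_add)
      have s1: "1 < s" using sj j1 by linarith
      have y0: "y \<noteq> 0" using s1 by (auto simp: s_def)
      have "2 ^ j \<le> 1 + s" using sj s0 by linarith
      then have w1: "w = 1" by (simp add: w_def cutoff_def s_def)
      have "2 * R \<le> s" using Rj sj by linarith
      then have r: "0 \<le> r" "r \<le> 1 / 2"
        using s1 R by (auto simp: r_def divide_simps simp flip: R_def s_def)
      note gen = distance_power_conv_generating_function[OF y0 xpos, folded t_def r_def]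
      have "\<bar>modified_poisson_kernel m x y\<bar> = c * (1 / s ^ n * \<bar>(1 - 2 * t * r + r\<^sup>2) powr (- (real n / 2)) -
          (\<Sum>k<m. gegenbauer (real n / 2) k t * r ^ k)\<bar>)"
        unfolding MPK[OF s1] gen(2) using c s0 by (simp add: s_def[symmetric] abs_mult flip: diff_divide_distrib)
      also have "\<dots> \<le> c * (1 / s ^ n * (A * r ^ m))"
        using c s0 Atail[OF gen(1) r] by (intro mult_left_mono) auto
      also have "1 / s ^ n * (A * r ^ m) = A * R ^ m * (1 / s ^ N)"
        by (simp add: r_def R_def s_def N_def power_divide power_add)
      also have "\<dots> \<le> A * R ^ m * (2 / (1 + s ^ N))"
        using s_one s1 A0 R by (intro mult_left_mono) auto
      also have "\<dots> = (2 * A) * R ^ m * (w / (1 + s ^ N))"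
        by (simp add: w1)
      also have "\<dots> \<le> C * R ^ m * (w / (1 + s ^ N))"
        using A0 R w s0 by (intro mult_right_mono) (auto simp: C_def)
      also have "\<dots> \<le> indicator (thick_annulus j) y / norm (x - (y, 0)) ^ n + C * R ^ m * (w / (1 + s ^ N))"
        by simp
      finally show ?thesis using c by simp
    next
      case sj: True
      have poly: "\<bar>modified_poisson_kernel m x y - poisson_kernel x y\<bar> \<le>
          c * (2 * real m * A * 16 ^ m * R ^ m * (w / (1 + s ^ N)))"
      proof (cases "1 < s")
        case False
        then show ?thesis
          using c A0 R w s0 by (simp add: modified_poisson_kernel_def s_def[symmetric])
      next
        case s1: True
        then have y0: "y \<noteq> 0" by (auto simp: s_def)
        note t1 = distance_power_conv_generating_function(1)[OF y0 xpos, folded t_def]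
        have le_min: "a \<le> 16 * min 1 q" if "a \<le> 16" "a \<le> q" "0 \<le> q" for a q :: real
          using that by (simp add: min_def)
        have "s / 2 ^ j \<le> 16" using sj by (simp add: power_add field_simps)
        moreover have "s / 2 ^ j \<le> (1 + s) / 2 ^ j" by (simp add: divide_right_mono)
        moreover have "0 \<le> (1 + s) / 2 ^ j" using s0 by simp
        ultimately have sw: "s / 2 ^ j \<le> 16 * w"
          unfolding w_def cutoff_def s_def[symmetric] by (rule le_min)
        have "s / R \<le> s / 2 ^ j" using s0 Rj j1 by (intro divide_left_mono) auto
        with sw have sR: "s / R \<le> 16 * w" by simp
        have term_le: "\<bar>gegenbauer (real n / 2) k t * (1 / s ^ n * r ^ k)\<bar> \<le>
            A * (R ^ m * (16 ^ m * w * (2 / (1 + s ^ N))))" if k: "k < m" for k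
        proof -
          \<comment> \<open>Trade the missing powers of \<open>r\<close> for powers of \<open>s / R = 1 / r\<close>.\<close>
          have "r ^ k = r ^ m * (s / R) ^ (m - k)"
          proof -
            have "r ^ m = r ^ k * r ^ (m - k)" using k by (simp flip: power_add)
            moreover have "r * (s / R) = 1"
              using s1 R unfolding r_def R_def[symmetric] s_def[symmetric] by simp
            then have "r ^ (m - k) * (s / R) ^ (m - k) = 1"
              by (simp only: power_mult_distrib[symmetric] power_one)
            ultimately show ?thesis by (simp add: mult.assoc)
          qed
          then have "1 / s ^ n * r ^ k = R ^ m * ((s / R) ^ (m - k) * (1 / s ^ N))"
            by (simp add: r_def R_def s_def N_def power_divide power_add)
          also have "\<dots> \<le> R ^ m * (16 ^ m * w * (2 / (1 + s ^ N)))"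
          proof (intro mult_left_mono mult_mono s_one)
            have "(s / R) ^ (m - k) \<le> (16 * w) ^ (m - k)"
              using sR s0 R by (intro power_mono) auto
            also have "\<dots> = 16 ^ (m - k) * w ^ (m - k)" by (rule power_mult_distrib)
            also have "\<dots> \<le> 16 ^ m * w"
              using w k power_decreasing[of 1 "m - k" w] by (intro mult_mono power_increasing) auto
            finally show "(s / R) ^ (m - k) \<le> 16 ^ m * w" .
          qed (use s1 R w in auto)
          finally have *: "1 / s ^ n * r ^ k \<le> R ^ m * (16 ^ m * w * (2 / (1 + s ^ N)))" .
          have "0 \<le> 1 / s ^ n * r ^ k" using s0 by (simp add: r_def)
          then have "\<bar>gegenbauer (real n / 2) k t * (1 / s ^ n * r ^ k)\<bar> =
              \<bar>gegenbauer (real n / 2) k t\<bar> * (1 / s ^ n * r ^ k)"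
            unfolding abs_mult[of "gegenbauer (real n / 2) k t"] by (simp only: abs_of_nonneg)
          also have "\<dots> \<le> A * (R ^ m * (16 ^ m * w * (2 / (1 + s ^ N))))"
            by (rule mult_mono[OF AC[OF t1 k] * A0 \<open>0 \<le> 1 / s ^ n * r ^ k\<close>])
          finally show ?thesis .
        qed
        have "\<bar>modified_poisson_kernel m x y - poisson_kernel x y\<bar> =
            c * \<bar>\<Sum>k<m. gegenbauer (real n / 2) k t * (1 / s ^ n * r ^ k)\<bar>"
        proof -
          have "(\<Sum>k<m. gegenbauer (real n / 2) k t * (1 / s ^ n * r ^ k)) =
              1 / s ^ n * (\<Sum>k<m. gegenbauer (real n / 2) k t * r ^ k)"
            by (simp add: sum_distrib_left mult_ac)
          moreover have "\<bar>c * (a - b) - c * a\<bar> = c * \<bar>b\<bar>" for a b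
            using c by (simp add: right_diff_distrib abs_mult)
          ultimately show ?thesis
            by (simp only: MPK[OF s1] PK)
        qed
        also have "\<dots> \<le> c * (\<Sum>k<m. A * (R ^ m * (16 ^ m * w * (2 / (1 + s ^ N)))))"
          using c by (intro mult_left_mono order_trans[OF sum_abs] sum_mono term_le) auto
        finally show ?thesis by (simp add: mult_ac)
      qed
      have near: "1 / norm (x - (y, 0)) ^ n \<le> indicator (thick_annulus j) y / norm (x - (y, 0)) ^ n +
          2 * 2 ^ n * R ^ m * (w / (1 + s ^ N))"
      proof (cases "2 ^ j < s")
        case True
        then show ?thesis using sj R w s0 by (simp add: thick_annulus_def s_def)
      next
        case False
        have "R - s \<le> norm (x - (y, 0))"
          using norm_triangle_ineq2[of x "(y, 0)"] by (simp add: R_def s_def)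
        then have "R / 2 \<le> norm (x - (y, 0))" using False Rj by simp
        then have "1 / norm (x - (y, 0)) ^ n \<le> 1 / (R / 2) ^ n"
          using R by (intro divide_left_mono power_mono mult_pos_pos zero_less_power) auto
        also have "\<dots> = 2 ^ n * R ^ m * (1 / R ^ N)"
          using R by (simp add: N_def power_divide power_add)
        also have "\<dots> \<le> 2 ^ n * R ^ m * (2 * w / (1 + s ^ N))"
          unfolding w_def s_def using R False Rj
          by (intro mult_left_mono inverse_power_le_cutoff) (auto simp: N_def n_def s_def)
        also have "\<dots> = 2 * 2 ^ n * R ^ m * (w / (1 + s ^ N))" by simp
        also have "\<dots> \<le> indicator (thick_annulus j) y / norm (x - (y, 0)) ^ n + \<dots>" by simp
        finally show ?thesis .
      qed
      have "\<bar>modified_poisson_kernel m x y\<bar> \<le> c * (1 / norm (x - (y, 0)) ^ n) +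
          c * (2 * real m * A * 16 ^ m * R ^ m * (w / (1 + s ^ N)))"
      proof -
        have "0 \<le> c * (1 / norm (x - (y, 0)) ^ n)" using c by simp
        then show ?thesis using poly unfolding PK by linarith
      qed
      also have "\<dots> \<le> c * (indicator (thick_annulus j) y / norm (x - (y, 0)) ^ n +
          2 * 2 ^ n * R ^ m * (w / (1 + s ^ N))) + c * (2 * real m * A * 16 ^ m * R ^ m * (w / (1 + s ^ N)))"
        using c by (intro add_right_mono mult_left_mono near) simp
      also have "\<dots> = c * (indicator (thick_annulus j) y / norm (x - (y, 0)) ^ n +
          (2 * 2 ^ n + 2 * real m * A * 16 ^ m) * R ^ m * (w / (1 + s ^ N)))"
        by (simp add: algebra_simps)
      also have "\<dots> \<le> c * (indicator (thick_annulus j) y / norm (x - (y, 0)) ^ n + C * R ^ m * (w / (1 + s ^ N)))"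
        using c A0 R w s0 by (intro mult_left_mono add_left_mono mult_right_mono) (auto simp: C_def)
      finally show ?thesis .
    qed
    then show ?thesis by (simp add: c_def R_def s_def w_def)
  qed
  moreover have "0 \<le> C" using A0 by (simp add: C_def)
  ultimately show ?thesis using that[of C] unfolding n_def N_def by blast
qed

section \<open>Sweeping mass out of a ball by inversion\<close>

text \<open>
  On the sphere \<open>\<bar>x\<bar> = \<rho>\<close> this is the equality of Apollonius.  Off the sphere, the difference of
  the squares of both sides is \<open>(\<rho>\<^sup>2 / \<bar>y\<bar>\<^sup>2 - 1) (\<bar>x\<bar>\<^sup>2 - \<rho>\<^sup>2)\<close>, which has the right sign when
  \<open>y\<close> lies inside and \<open>x\<close> outside.
\<close>

lemma norm_diff_inversion_le:
  fixes x y :: "'a::real_inner"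
  assumes y: "0 < norm y" "norm y \<le> \<rho>" and x: "\<rho> \<le> norm x"
  shows "norm (x - (\<rho>\<^sup>2 / (norm y)\<^sup>2) *\<^sub>R y) \<le> \<rho> / norm y * norm (x - y)"
proof (rule power2_le_imp_le)
  define s where "s = norm y"
  have s: "0 < s" "s \<le> \<rho>" using y by (auto simp: s_def)
  have yy: "y \<bullet> y = s\<^sup>2" by (simp add: s_def power2_norm_eq_inner)
  have 1: "(norm (x - (\<rho>\<^sup>2 / s\<^sup>2) *\<^sub>R y))\<^sup>2 = x \<bullet> x - 2 * (\<rho>\<^sup>2 / s\<^sup>2) * (x \<bullet> y) + (\<rho>\<^sup>2 / s\<^sup>2)\<^sup>2 * s\<^sup>2"
    by (simp only: power2_norm_eq_inner inner_diff_left inner_diff_right inner_scaleR_left inner_scaleR_right yy)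
       (simp add: inner_commute power2_eq_square algebra_simps)
  have 2: "(\<rho> / s * norm (x - y))\<^sup>2 = \<rho>\<^sup>2 / s\<^sup>2 * (x \<bullet> x - 2 * (x \<bullet> y) + s\<^sup>2)"
    by (simp only: power_mult_distrib power_divide power2_norm_eq_inner inner_diff_left inner_diff_right yy)
       (simp add: inner_commute algebra_simps)
  have "0 \<le> (\<rho>\<^sup>2 / s\<^sup>2 - 1) * (x \<bullet> x - \<rho>\<^sup>2)"
    using s x power_mono[of s \<rho> 2] power_mono[of \<rho> "norm x" 2]
    by (intro mult_nonneg_nonneg) (auto simp: power2_norm_eq_inner)
  also have "\<dots> = (\<rho> / s * norm (x - y))\<^sup>2 - (norm (x - (\<rho>\<^sup>2 / s\<^sup>2) *\<^sub>R y))\<^sup>2"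
    unfolding 1 2 using s by (simp add: field_simps power2_eq_square)
  finally show "(norm (x - (\<rho>\<^sup>2 / (norm y)\<^sup>2) *\<^sub>R y))\<^sup>2 \<le> (\<rho> / norm y * norm (x - y))\<^sup>2"
    by (simp add: s_def)
  show "0 \<le> \<rho> / norm y * norm (x - y)"
    using s by (simp add: s_def[symmetric])
qed

lemma negligible_inversion_image:
  fixes Z :: "'a::euclidean_space set"
  assumes "negligible Z"
  shows "negligible ((\<lambda>y. (c / (norm y)\<^sup>2) *\<^sub>R y) ` (Z - {0}))"
proof (rule negligible_differentiable_image_negligible)
  show "negligible (Z - {0})"
    using assms negligible_subset by blast
  have "(\<lambda>y. (c / (y \<bullet> y)) *\<^sub>R y) differentiable_on (Z - {0})"
    unfolding differentiable_on_def by (auto intro!: derivative_intros)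
  then show "(\<lambda>y. (c / (norm y)\<^sup>2) *\<^sub>R y) differentiable_on (Z - {0})"
    by (simp add: power2_norm_eq_inner)
qed simp

text \<open>
  The density \<open>u\<close> on the annulus \<open>A\<close> is pushed forward by the map \<open>T\<close> that inverts the points
  inside the sphere of radius \<open>\<rho>\<close> and fixes the others.  Total mass is preserved, and
  distances to a point with \<open>\<bar>x\<bar> \<ge> \<rho>\<close> grow at most by a factor \<open>2\<close>.  Working with the image measure and its
  Radon--Nikodym density, instead of a formula for the density, avoids the Jacobian of the inversion.
\<close>

lemma sweep_mass_out_of_ball:
  fixes u :: "real ^ 'd \<Rightarrow> ennreal" and \<rho> :: real
  defines "A \<equiv> {y. \<rho> / 2 < norm y \<and> norm y < 8 * \<rho>}"
    and "F \<equiv> {y. \<rho> < norm y \<and> norm y < 8 * \<rho>}"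
  assumes u: "u \<in> borel_measurable lborel" and \<rho>: "0 < \<rho>"
    and fin: "(\<integral>\<^sup>+y. u y * indicator A y \<partial>lborel) < \<infinity>"
  obtains g :: "real ^ 'd \<Rightarrow> real" where
    "g \<in> borel_measurable lborel" "\<And>y. 0 \<le> g y" "\<And>y. y \<notin> F \<Longrightarrow> g y = 0"
    "(\<integral>\<^sup>+y. ennreal (g y) \<partial>lborel) \<le> (\<integral>\<^sup>+y. u y * indicator A y \<partial>lborel)"
    "\<And>x :: 'd point. 0 < snd x \<Longrightarrow> \<rho> \<le> norm x \<Longrightarrow>
       (\<integral>\<^sup>+y. u y * indicator A y * ennreal (1 / norm (x - (y, 0)) ^ p) \<partial>lborel) \<le>
       2 ^ p * (\<integral>\<^sup>+y. ennreal (g y / norm (x - (y, 0)) ^ p) \<partial>lborel)"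
proof -
  note [measurable] = u
  define I where "I y = (\<rho>\<^sup>2 / (norm y)\<^sup>2) *\<^sub>R y" for y :: "real ^ 'd"
  define T where "T y = (if norm y < \<rho> then I y else y)" for y
  \<comment> \<open>The sphere is removed since \<open>T\<close> fixes it and it is disjoint from \<open>F\<close>; it is a null set.\<close>
  define B where "B = A - sphere 0 \<rho>"
  have I_meas [measurable]: "I \<in> borel_measurable borel"
    unfolding I_def by measurable
  have T_meas [measurable]: "T \<in> borel_measurable borel"
    unfolding T_def by measurable
  have A_meas [measurable]: "A \<in> sets borel" unfolding A_def by measurable
  have F_meas [measurable]: "F \<in> sets borel" unfolding F_def by measurable
  have B_meas [measurable]: "B \<in> sets borel" unfolding B_def by measurable
  have normI: "norm (I y) = \<rho>\<^sup>2 / norm y" if "y \<noteq> 0" for y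
    using that by (simp add: I_def power2_eq_square)
  have II: "I (I y) = y" if "y \<noteq> 0" for y
    using that \<rho> normI[OF that] by (subst I_def) (simp add: I_def field_simps power2_eq_square)
  have TF: "T y \<in> F" if "y \<in> B" for y
  proof (cases "norm y < \<rho>")
    case True
    then have y: "\<rho> / 2 < norm y" "norm y < \<rho>" "y \<noteq> 0" using that \<rho> by (auto simp: B_def A_def)
    then have "\<rho> * norm y < \<rho> * \<rho>" "\<rho> * \<rho> < 8 * \<rho> * norm y" using \<rho> by auto
    then show ?thesis
      using y \<rho> by (auto simp: T_def F_def normI power2_eq_square field_simps)
  qed (use that in \<open>auto simp: T_def F_def B_def A_def\<close>)
  have AB: "AE y in lborel. indicator A y = (indicator B y :: ennreal)"
  proof -
    have "sphere (0 :: real ^ 'd) \<rho> \<in> null_sets lborel"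
      using negligible_sphere[of 0 \<rho>] by (simp add: negligible_iff_null_sets null_sets_completion_iff)
    from AE_not_in[OF this] show ?thesis
      by eventually_elim (auto simp: B_def indicator_def)
  qed
  define \<nu> where "\<nu> = distr (density lborel (\<lambda>y. u y * indicator B y)) lborel T"
  have nu: "(\<integral>\<^sup>+y. \<phi> y \<partial>\<nu>) = (\<integral>\<^sup>+y. u y * indicator B y * \<phi> (T y) \<partial>lborel)"
    if [measurable]: "\<phi> \<in> borel_measurable borel" for \<phi> :: "real ^ 'd \<Rightarrow> ennreal"
    unfolding \<nu>_def by (simp add: nn_integral_distr nn_integral_density)
  have "absolutely_continuous lborel \<nu>"
    unfolding absolutely_continuous_def
  proof
    fix Z assume Z: "Z \<in> null_sets (lborel :: (real ^ 'd) measure)"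
    then have [measurable]: "Z \<in> sets borel" by auto
    have "negligible Z" using Z by (simp add: negligible_iff_null_sets null_sets_completionI)
    then have "negligible (Z \<union> I ` (Z - {0}))"
      unfolding I_def by (intro negligible_Un negligible_inversion_image)
    then have "AE y in lebesgue. y \<notin> Z \<union> I ` (Z - {0})"
      by (intro AE_not_in) (simp add: negligible_iff_null_sets)
    then have "AE y in lborel. y \<notin> Z \<union> I ` (Z - {0})"
      by (simp add: AE_completion_iff)
    then have "AE y in lborel. u y * indicator B y * indicator Z (T y) = 0"
    proof eventually_elim
      case (elim y)
      have "T y \<notin> Z" if "y \<in> B"
      proof
        assume TZ: "T y \<in> Z"
        with elim have lt: "norm y < \<rho>" by (auto simp: T_def split: if_splits)
        have y0: "y \<noteq> 0" using that \<rho> by (auto simp: B_def A_def)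
        have "norm (I y) \<noteq> 0" using y0 normI[OF y0] \<rho> by simp
        then have "I y \<noteq> 0" by simp
        \<comment> \<open>The inversion is an involution, so preimages under it are images.\<close>
        then have "y \<in> I ` (Z - {0})"
          using TZ lt II[OF y0] by (intro image_eqI[of _ _ "I y"]) (auto simp: T_def)
        with elim show False by simp
      qed
      then show ?case by (auto simp: indicator_def)
    qed
    then have "emeasure \<nu> Z = 0"
      using nu[of "indicator Z"] by (simp add: \<nu>_def nn_integral_0_iff_AE)
    then show "Z \<in> null_sets \<nu>" by (auto simp: \<nu>_def)
  qed
  moreover have sets_nu: "sets \<nu> = sets lborel" by (simp add: \<nu>_def)
  ultimately obtain g0 where g0 [measurable]: "g0 \<in> borel_measurable lborel"
    and dens: "density lborel g0 = \<nu>"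
    using sigma_finite_measure.Radon_Nikodym[OF sigma_finite_lborel] by blast
  have g0_int: "(\<integral>\<^sup>+y. g0 y * \<phi> y \<partial>lborel) = (\<integral>\<^sup>+y. u y * indicator B y * \<phi> (T y) \<partial>lborel)"
    if [measurable]: "\<phi> \<in> borel_measurable borel" for \<phi> :: "real ^ 'd \<Rightarrow> ennreal"
    unfolding nu[OF that, symmetric] dens[symmetric] by (simp add: nn_integral_density)
  have "(\<integral>\<^sup>+y. g0 y * indicator (- F) y \<partial>lborel) = 0"
  proof -
    have "(\<lambda>y. u y * indicator B y * indicator (- F) (T y)) = (\<lambda>_. 0)"
      using TF by (auto simp: indicator_def fun_eq_iff)
    from g0_int[of "indicator (- F)", unfolded this] show ?thesis by simp
  qed
  then have outside: "AE y in lborel. g0 y * indicator (- F) y = 0"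
    by (subst (asm) nn_integral_0_iff_AE) auto
  have total: "(\<integral>\<^sup>+y. g0 y \<partial>lborel) = (\<integral>\<^sup>+y. u y * indicator A y \<partial>lborel)"
  proof -
    have "(\<integral>\<^sup>+y. g0 y \<partial>lborel) = (\<integral>\<^sup>+y. u y * indicator B y \<partial>lborel)"
      using g0_int[of "\<lambda>_. 1"] by simp
    also have "\<dots> = (\<integral>\<^sup>+y. u y * indicator A y \<partial>lborel)"
      by (rule nn_integral_cong_AE) (use AB in eventually_elim, simp)
    finally show ?thesis .
  qed
  then have "AE y in lborel. g0 y \<noteq> \<infinity>"
    using fin by (intro nn_integral_noteq_infinite) auto
  \<comment> \<open>The density \<open>g0\<close> is determined only almost everywhere; \<open>g\<close> is a version that is finite and
    vanishes off \<open>F\<close> at every point.\<close>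
  define g where "g y = enn2real (g0 y) * indicator F y" for y
  have g_meas [measurable]: "g \<in> borel_measurable lborel" unfolding g_def by measurable
  have g_eq: "AE y in lborel. ennreal (g y) = g0 y"
    using outside \<open>AE y in lborel. g0 y \<noteq> \<infinity>\<close>
    by eventually_elim (auto simp: g_def indicator_def less_top split: if_splits)
  show thesis
  proof
    show "(\<integral>\<^sup>+y. ennreal (g y) \<partial>lborel) \<le> (\<integral>\<^sup>+y. u y * indicator A y \<partial>lborel)"
      unfolding total[symmetric] by (rule nn_integral_mono_AE) (use g_eq in eventually_elim, simp)
    fix x :: "'d point" assume x: "0 < snd x" "\<rho> \<le> norm x"
    define k where "k y = norm (x - (y, 0))" for y
    have k0: "0 < k y" for y
      using x by (cases x) (auto simp: k_def prod_eq_iff)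
    have k_meas [measurable]: "k \<in> borel_measurable borel"
      unfolding k_def by (intro borel_measurable_continuous_onI continuous_intros)
    have kT: "k (T y) \<le> 2 * k y" if "y \<in> B" for y
    proof (cases "norm y < \<rho>")
      case True
      then have y: "\<rho> / 2 < norm y" "y \<noteq> 0" using that \<rho> by (auto simp: B_def A_def)
      have "k (T y) = norm (x - (\<rho>\<^sup>2 / (norm (y, 0::real))\<^sup>2) *\<^sub>R (y, 0))"
        using True by (simp add: k_def T_def I_def)
      also have "\<dots> \<le> \<rho> / norm (y, 0::real) * norm (x - (y, 0))"
        by (rule norm_diff_inversion_le) (use True y x in auto)
      also have "\<dots> \<le> 2 * norm (x - (y, 0))"
        using y \<rho> by (intro mult_right_mono) (auto simp: field_simps)
      finally show ?thesis by (simp add: k_def)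
    qed (use k0[of y] in \<open>auto simp: T_def\<close>)
    have "(\<integral>\<^sup>+y. u y * indicator A y * ennreal (1 / k y ^ p) \<partial>lborel) =
        (\<integral>\<^sup>+y. u y * indicator B y * ennreal (1 / k y ^ p) \<partial>lborel)"
      by (rule nn_integral_cong_AE) (use AB in eventually_elim, simp)
    also have "\<dots> \<le> (\<integral>\<^sup>+y. 2 ^ p * (u y * indicator B y * ennreal (1 / k (T y) ^ p)) \<partial>lborel)"
    proof (rule nn_integral_mono)
      fix y
      have "ennreal (1 / k y ^ p) \<le> 2 ^ p * ennreal (1 / k (T y) ^ p)" if "y \<in> B"
      proof -
        have "k (T y) ^ p \<le> 2 ^ p * k y ^ p"
          using power_mono[OF kT[OF that], of p] k0[of "T y"] by (simp add: power_mult_distrib)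
        then have "1 / k y ^ p \<le> 2 ^ p * (1 / k (T y) ^ p)"
          using k0[of y] k0[of "T y"] by (simp add: field_simps)
        then have "ennreal (1 / k y ^ p) \<le> ennreal (2 ^ p * (1 / k (T y) ^ p))"
          by (rule ennreal_leI)
        also have "\<dots> = 2 ^ p * ennreal (1 / k (T y) ^ p)"
          using k0[of "T y"] by (subst ennreal_mult) (auto simp: ennreal_power[symmetric])
        finally show ?thesis .
      qed
      then have "u y * indicator B y * ennreal (1 / k y ^ p) \<le>
          u y * indicator B y * (2 ^ p * ennreal (1 / k (T y) ^ p))"
        by (cases "y \<in> B") (auto intro: mult_left_mono)
      then show "u y * indicator B y * ennreal (1 / k y ^ p) \<le>
          2 ^ p * (u y * indicator B y * ennreal (1 / k (T y) ^ p))"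
        by (simp add: mult_ac)
    qed
    also have "\<dots> = 2 ^ p * (\<integral>\<^sup>+y. g0 y * ennreal (1 / k y ^ p) \<partial>lborel)"
      by (subst nn_integral_cmult) (simp_all add: g0_int)
    also have "(\<integral>\<^sup>+y. g0 y * ennreal (1 / k y ^ p) \<partial>lborel) = (\<integral>\<^sup>+y. ennreal (g y / k y ^ p) \<partial>lborel)"
    proof (rule nn_integral_cong_AE)
      show "AE y in lborel. g0 y * ennreal (1 / k y ^ p) = ennreal (g y / k y ^ p)"
        using g_eq
      proof eventually_elim
        case (elim y)
        show ?case
          unfolding elim[symmetric] using k0[of y]
          by (subst ennreal_mult'[symmetric]) (auto simp: g_def)
      qed
    qed
    finally show "(\<integral>\<^sup>+y. u y * indicator A y * ennreal (1 / norm (x - (y, 0)) ^ p) \<partial>lborel) \<le>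
       2 ^ p * (\<integral>\<^sup>+y. ennreal (g y / norm (x - (y, 0)) ^ p) \<partial>lborel)"
      by (simp add: k_def)
  qed (auto simp: g_def g_meas)
qed

text \<open>
  After its mass has been swept into \<open>F\<close>, the density \<open>u\<close> multiplied by \<open>2\<^sup>n / \<delta>\<close> is a competitor
  for the capacity of any set outside the ball on which its potential is at least \<open>\<delta>\<close>.
\<close>

lemma boundary_capacity_le:
  fixes E :: "('d::finite) point set" and u :: "real ^ 'd \<Rightarrow> ennreal" and \<rho> :: real
  defines "A \<equiv> {y. \<rho> / 2 < norm y \<and> norm y < 8 * \<rho>}"
  assumes u: "u \<in> borel_measurable lborel" and \<rho>: "0 < \<rho>" and \<delta>: "0 < \<delta>"
    and n: "n = CARD('d) + 1"
    and E: "\<And>x. x \<in> E \<Longrightarrow> 0 < snd x \<and> \<rho> \<le> norm x"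
    and big: "\<And>x. x \<in> E \<Longrightarrow>
      ennreal \<delta> \<le> (\<integral>\<^sup>+y. u y * indicator A y * ennreal (1 / norm (x - (y, 0)) ^ n) \<partial>lborel)"
  shows "boundary_capacity E {y. \<rho> < norm y \<and> norm y < 8 * \<rho>} \<le>
    ennreal (2 ^ n / \<delta>) * (\<integral>\<^sup>+y. u y * indicator A y \<partial>lborel)"
proof (cases "(\<integral>\<^sup>+y. u y * indicator A y \<partial>lborel) < \<infinity>")
  case False
  then have "ennreal (2 ^ n / \<delta>) * (\<integral>\<^sup>+y. u y * indicator A y \<partial>lborel) = top"
    using \<delta> by (simp add: not_less top_unique ennreal_mult_top)
  then show ?thesis by simp
next
  case True
  obtain g :: "real ^ 'd \<Rightarrow> real" where g [measurable]: "g \<in> borel_measurable lborel"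
    and g0: "\<And>y. 0 \<le> g y"
    and gF: "\<And>y. y \<notin> {y. \<rho> < norm y \<and> norm y < 8 * \<rho>} \<Longrightarrow> g y = 0"
    and gu: "(\<integral>\<^sup>+y. ennreal (g y) \<partial>lborel) \<le> (\<integral>\<^sup>+y. u y * indicator A y \<partial>lborel)"
    and gx: "\<And>x :: 'd point. 0 < snd x \<Longrightarrow> \<rho> \<le> norm x \<Longrightarrow>
       (\<integral>\<^sup>+y. u y * indicator A y * ennreal (1 / norm (x - (y, 0)) ^ n) \<partial>lborel) \<le>
       2 ^ n * (\<integral>\<^sup>+y. ennreal (g y / norm (x - (y, 0)) ^ n) \<partial>lborel)"
    unfolding A_def
    by (rule sweep_mass_out_of_ball[OF u \<rho> True[unfolded A_def], where p = n])
       (rule that[unfolded A_def]; assumption)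
  define c where "c = 2 ^ n / \<delta>"
  have c: "0 < c" using \<delta> by (simp add: c_def)
  have "1 \<le> (\<integral>\<^sup>+y. ennreal (c * g y / norm (x - (y, 0)) ^ n) \<partial>lborel)" if "x \<in> E" for x
  proof -
    have [measurable]: "(\<lambda>y. norm (x - (y, 0))) \<in> borel_measurable borel"
      by (intro borel_measurable_continuous_onI continuous_intros)
    have "1 = ennreal (1 / \<delta>) * ennreal \<delta>"
      using \<delta> by (simp flip: ennreal_mult)
    also have "\<dots> \<le> ennreal (1 / \<delta>) * (2 ^ n * (\<integral>\<^sup>+y. ennreal (g y / norm (x - (y, 0)) ^ n) \<partial>lborel))"
      by (intro mult_left_mono order_trans[OF big[OF that] gx]) (use E[OF that] in auto)
    also have "\<dots> = ennreal (1 / \<delta>) * ennreal (2 ^ n) * (\<integral>\<^sup>+y. ennreal (g y / norm (x - (y, 0)) ^ n) \<partial>lborel)"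
      by (simp add: ennreal_power[symmetric] mult.assoc)
    also have "ennreal (1 / \<delta>) * ennreal (2 ^ n) = ennreal c"
      using \<delta> by (subst ennreal_mult[symmetric]) (auto simp: c_def)
    also have "ennreal c * (\<integral>\<^sup>+y. ennreal (g y / norm (x - (y, 0)) ^ n) \<partial>lborel) =
        (\<integral>\<^sup>+y. ennreal (c * g y / norm (x - (y, 0)) ^ n) \<partial>lborel)"
      using c g0 by (subst nn_integral_cmult[symmetric]) (simp_all flip: ennreal_mult)
    finally show ?thesis .
  qed
  then have "(\<lambda>y. c * g y) \<in> {g \<in> borel_measurable lebesgue. (\<forall>y. 0 \<le> g y) \<and>
      (\<forall>y. y \<notin> {y. \<rho> < norm y \<and> norm y < 8 * \<rho>} \<longrightarrow> g y = 0) \<and>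
      (\<forall>x\<in>E. 1 \<le> (\<integral>\<^sup>+ y. ennreal (g y / norm (x - (y, 0)) ^ n) \<partial>lebesgue))}"
    using c g0 gF measurable_completion[of "\<lambda>y. c * g y" lborel borel]
    unfolding nn_integral_completion by (intro CollectI conjI ballI allI impI) simp_all
  then have "boundary_capacity E {y. \<rho> < norm y \<and> norm y < 8 * \<rho>} \<le>
      (\<integral>\<^sup>+y. ennreal (c * g y) \<partial>lebesgue)"
    unfolding boundary_capacity_def Let_def n[symmetric]
    by (intro INF_lower) simp
  also have "\<dots> = (\<integral>\<^sup>+y. ennreal c * ennreal (g y) \<partial>lborel)"
    using c by (simp only: nn_integral_completion ennreal_mult' less_imp_le)
  also have "\<dots> = ennreal c * (\<integral>\<^sup>+y. ennreal (g y) \<partial>lborel)"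
    by (rule nn_integral_cmult) measurable
  also have "\<dots> \<le> ennreal c * (\<integral>\<^sup>+y. u y * indicator A y \<partial>lborel)"
    by (intro mult_left_mono gu) simp
  finally show ?thesis by (simp add: c_def)
qed

section \<open>Slowly decreasing thresholds and vanishing weights\<close>

text \<open>
  Think of \<open>T j\<close> as the tail of a convergent series whose terms, \<open>p\<close> at a time, dominate \<open>a j\<close>.
  From \<open>a - b = (\<surd>a + \<surd>b)(\<surd>a - \<surd>b)\<close> the quotient \<open>a j / \<surd>(T j)\<close> is at most
  \<open>2 (\<surd>(T j) - \<surd>(T (j + p)))\<close>, and these differences telescope.  The lag \<open>p\<close> accounts for
  overlapping annuli.
\<close>

lemma summable_divide_sqrt_tail:
  fixes a T :: "nat \<Rightarrow> real"
  assumes T: "\<And>j. 0 < T j" and a: "\<And>j. 0 \<le> a j" and aT: "\<And>j. a j \<le> T j - T (j + p)"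
  shows "summable (\<lambda>j. a j / sqrt (T j))"
proof (rule summableI_nonneg_bounded)
  define s where "s j = sqrt (T j)" for j
  have s: "0 < s j" for j using T by (simp add: s_def)
  show "0 \<le> a j / sqrt (T j)" for j using a T less_imp_le by (simp add: divide_nonneg_pos)
  have le: "a j / sqrt (T j) \<le> 2 * (s j - s (j + p))" for j
  proof -
    have "T (j + p) \<le> T j" using a[of j] aT[of j] by simp
    then have mono: "s (j + p) \<le> s j" by (simp add: s_def)
    have "T j - T (j + p) = (s j + s (j + p)) * (s j - s (j + p))"
      using T[THEN less_imp_le] by (simp add: s_def algebra_simps flip: power2_eq_square)
    also have "\<dots> \<le> (2 * s j) * (s j - s (j + p))"
      using mono by (intro mult_right_mono) auto
    finally have "a j \<le> 2 * (s j - s (j + p)) * s j" using aT[of j] by (simp add: mult_ac)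
    then show ?thesis using s[of j] by (simp add: s_def[symmetric] pos_divide_le_eq)
  qed
  have lag: "(\<Sum>j<N. s j - s (j + p)) = (\<Sum>i<p. s i - s (i + N))" for N
  proof (induction N)
    case (Suc N)
    have "(\<Sum>i<p. s (i + N) - s (Suc i + N)) = s N - s (p + N)"
      using sum_lessThan_telescope'[of "\<lambda>i. s (i + N)" p] by simp
    then have "(\<Sum>i<p. s i - s (i + Suc N)) = (\<Sum>i<p. s i - s (i + N)) + (s N - s (N + p))"
      by (simp add: sum_subtractf add.commute)
    then show ?case using Suc by simp
  qed simp
  show "(\<Sum>j<N. a j / sqrt (T j)) \<le> 2 * (\<Sum>i<p. s i)" for N
  proof -
    have "(\<Sum>j<N. a j / sqrt (T j)) \<le> 2 * (\<Sum>j<N. s j - s (j + p))"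
      unfolding sum_distrib_left by (intro sum_mono le)
    also have "\<dots> \<le> 2 * (\<Sum>i<p. s i)"
      unfolding lag using s[THEN less_imp_le] by (intro mult_left_mono sum_mono) auto
    finally show ?thesis .
  qed
qed

lemma integral_vanishing_weight:
  fixes h :: "'a \<Rightarrow> real"
  assumes h: "integrable M h" and [measurable]: "\<And>j. w j \<in> borel_measurable M"
    and w: "\<And>j y. 0 \<le> w j y \<and> w j y \<le> 1" and lim: "\<And>y. (\<lambda>j. w j y) \<longlonglongrightarrow> 0"
  shows "(\<lambda>j. \<integral>y. h y * w j y \<partial>M) \<longlonglongrightarrow> 0" and "integrable M (\<lambda>y. h y * w j y)"
proof -
  have [measurable]: "h \<in> borel_measurable M" using h by auto
  have le: "\<bar>h y * w j y\<bar> \<le> \<bar>h y\<bar>" for j y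
    using w[of j y] by (simp add: abs_mult mult_left_le)
  show "integrable M (\<lambda>y. h y * w j y)"
    by (rule Bochner_Integration.integrable_bound[OF h]) (use le in auto)
  have "(\<lambda>j. \<integral>y. h y * w j y \<partial>M) \<longlonglongrightarrow> (\<integral>y. 0 \<partial>M)"
    by (rule integral_dominated_convergence[where w = "\<lambda>y. \<bar>h y\<bar>"])
       (use le h tendsto_mult[OF tendsto_const lim] in auto)
  then show "(\<lambda>j. \<integral>y. h y * w j y \<partial>M) \<longlonglongrightarrow> 0" by simp
qed

lemma cutoff_tendsto_0: "(\<lambda>j. cutoff j y) \<longlonglongrightarrow> 0"
proof (rule tendsto_sandwich[where f = "\<lambda>_. 0" and h = "\<lambda>j. (1 + norm y) * (1/2) ^ j"])
  show "(\<lambda>j. (1 + norm y) * (1/2) ^ j) \<longlonglongrightarrow> 0"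
    by (intro tendsto_mult_right_zero LIMSEQ_realpow_zero) auto
  have "cutoff j y \<le> (1 + norm y) / 2 ^ j" for j
    by (simp add: cutoff_def)
  then have "cutoff j y \<le> (1 + norm y) * (1/2) ^ j" for j
    by (simp add: power_one_over)
  then show "\<forall>\<^sub>F j in sequentially. cutoff j y \<le> (1 + norm y) * (1/2) ^ j"
    by simp
  show "\<forall>\<^sub>F j in sequentially. 0 \<le> cutoff j y"
    by (simp add: cutoff_nonneg)
qed simp

lemma indicator_far_tendsto_0:
  fixes y :: "'a::real_normed_vector"
  shows "(\<lambda>j. indicator {y. 2 ^ j < norm y} y :: real) \<longlonglongrightarrow> 0"
proof (rule tendsto_eventually)
  obtain k where k: "norm y < 2 ^ k" using real_arch_pow[of 2 "norm y"] by auto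
  then have "norm y < 2 ^ j" if "k \<le> j" for j
    using order.strict_trans2[OF k power_increasing[OF that]] by simp
  then show "\<forall>\<^sub>F j in sequentially. indicator {y. 2 ^ j < norm y} y = (0::real)"
    by (intro eventually_sequentiallyI[of k]) (auto simp: indicator_def not_less less_imp_le)
qed

text \<open>
  When \<open>g\<close> is not integrable, the left-hand side vanishes by convention.
\<close>

lemma abs_integral_le_nn_integral:
  fixes g :: "'a \<Rightarrow> real"
  shows "ennreal \<bar>\<integral>y. g y \<partial>M\<bar> \<le> (\<integral>\<^sup>+y. ennreal \<bar>g y\<bar> \<partial>M)"
  using integral_norm_bound_ennreal[of M g]
  by (cases "integrable M g") (auto simp: not_integrable_integral_eq)

section \<open>The exceptional set\<close>

text \<open>
  The exceptional set collects the points where the potential of \<open>u\<close> restricted to the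
  \<open>j\<close>-th annulus is at least \<open>\<epsilon>\<^sub>j \<bar>x\<bar>\<^sup>m\<close>.  Its capacity in the \<open>j\<close>-th shell is at most a constant
  times the mass of \<open>u\<close> on the annulus divided by \<open>\<epsilon>\<^sub>j 2\<^bsup>jm\<^esup>\<close>, so minimal thinness reduces
  to the convergence of \<open>\<Sum> a\<^sub>j / \<epsilon>\<^sub>j\<close>, where \<open>a\<^sub>j\<close> is the integral of \<open>h\<close> over the annulus.
\<close>

lemma thin_exceptional_set:
  fixes u :: "real ^ 'd::finite \<Rightarrow> real" and n m :: nat
  defines "h \<equiv> \<lambda>y. u y / (1 + norm y ^ (n + m))"
  assumes n: "n = CARD('d) + 1" and u [measurable]: "u \<in> borel_measurable lborel"
    and u0: "\<And>y. 0 \<le> u y" and h: "integrable lborel h"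
  obtains \<epsilon> :: "nat \<Rightarrow> real" and E :: "'d point set" where
    "\<epsilon> \<longlonglongrightarrow> 0" "\<And>j. 0 < \<epsilon> j" "E \<subseteq> half_space" "minimally_thin_at_infinity E"
    "\<And>x. x \<in> half_space - E \<Longrightarrow> \<exists>j. 2 ^ (j + 1) \<le> norm x \<and> norm x < 2 ^ (j + 2) \<and>
       (\<integral>\<^sup>+y. ennreal (u y) * indicator (thick_annulus j) y * ennreal (1 / norm (x - (y, 0)) ^ n) \<partial>lborel)
         \<le> ennreal (\<epsilon> j * norm x ^ m)"
proof -
  define N where "N = n + m"
  have hN: "h y = u y / (1 + norm y ^ N)" and h0: "0 \<le> h y" for y
    using u0 by (simp_all add: h_def N_def)
  have [measurable]: "h \<in> borel_measurable lborel" using h by auto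
  have thick_meas [measurable]: "thick_annulus j \<in> sets (borel :: (real ^ 'd) measure)" for j
    unfolding thick_annulus_def by measurable
  define far where "far j = (\<integral>y. h y * indicator {y. 2 ^ j < norm y} y \<partial>lborel)" for j :: nat
  define a where "a j = (\<integral>y. h y * indicator (thick_annulus j) y \<partial>lborel)" for j
  \<comment> \<open>The tail of the integral of \<open>h\<close>, made positive by a summable perturbation so that its square
    root can be divided by even if \<open>h\<close> has bounded support.\<close>
  define T where "T j = far j + (1/2) ^ j" for j
  define \<epsilon> where "\<epsilon> j = sqrt (T j)" for j
  note far_weight = integral_vanishing_weight[OF h, of "\<lambda>j. indicator {y. 2 ^ j < norm y}"]
  have far_lim: "far \<longlonglongrightarrow> 0"
    unfolding far_def by (rule far_weight(1)) (auto intro: indicator_far_tendsto_0)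
  have far_int: "integrable lborel (\<lambda>y. h y * indicator {y. 2 ^ j < norm y} y)" for j :: nat
    by (rule far_weight(2)) (auto intro: indicator_far_tendsto_0)
  have thick_int: "integrable lborel (\<lambda>y. h y * indicator (thick_annulus j) y)" for j
    by (rule Bochner_Integration.integrable_bound[OF h]) (auto simp: indicator_def)
  have T0: "0 < T j" for j
    unfolding T_def far_def using h0 by (intro add_nonneg_pos Bochner_Integration.integral_nonneg) auto
  have a0: "0 \<le> a j" for j
    unfolding a_def using h0 by (intro Bochner_Integration.integral_nonneg) auto
  have aT: "a j \<le> T j - T (j + 4)" for j
  proof -
    have "a j \<le> (\<integral>y. h y * indicator {y. 2 ^ j < norm y} y - h y * indicator {y. 2 ^ (j + 4) < norm y} y \<partial>lborel)"
      unfolding a_def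
    proof (rule Bochner_Integration.integral_mono)
      fix y :: "real ^ 'd"
      have "2 ^ j < norm y" if "2 ^ (j + 4) < norm y"
        using that by (rule le_less_trans[rotated]) (intro power_increasing, auto)
      then show "h y * indicator (thick_annulus j) y \<le>
          h y * indicator {y. 2 ^ j < norm y} y - h y * indicator {y. 2 ^ (j + 4) < norm y} y"
        using h0[of y] by (auto simp: thick_annulus_def indicator_def)
    qed (intro thick_int far_int Bochner_Integration.integrable_diff)+
    also have "\<dots> = far j - far (j + 4)"
      unfolding far_def by (intro Bochner_Integration.integral_diff far_int)
    finally have "a j \<le> far j - far (j + 4)" .
    moreover have "(1/2::real) ^ (j + 4) \<le> (1/2) ^ j"
      by (rule power_decreasing) auto
    ultimately show ?thesis unfolding T_def by linarith
  qed
  have \<epsilon>0: "0 < \<epsilon> j" for j using T0 by (simp add: \<epsilon>_def)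
  have "T \<longlonglongrightarrow> 0"
    unfolding T_def using tendsto_add[OF far_lim LIMSEQ_realpow_zero[of "1/2"]] by simp
  then have \<epsilon>_lim: "\<epsilon> \<longlonglongrightarrow> 0"
    unfolding \<epsilon>_def using tendsto_real_sqrt by force
  have summ: "summable (\<lambda>j. a j / \<epsilon> j)"
    unfolding \<epsilon>_def by (rule summable_divide_sqrt_tail[where T = T and a = a and p = 4]) (rule T0 a0 aT)+
  define J where "J j x = (\<integral>\<^sup>+y. ennreal (u y) * indicator (thick_annulus j) y *
      ennreal (1 / norm (x - (y, 0)) ^ n) \<partial>lborel)" for j and x :: "'d point"
  \<comment> \<open>Points of norm less than \<open>2\<close> lie in no shell and so belong to \<open>E\<close>; every point outside \<open>E\<close>
    therefore comes with a shell in which its potential is small.\<close>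
  define E where "E = {x \<in> half_space. \<forall>j. 2 ^ (j + 1) \<le> norm x \<longrightarrow> norm x < 2 ^ (j + 2) \<longrightarrow>
      ennreal (\<epsilon> j * norm x ^ m) \<le> J j x}"
  define shell where "shell i = {x \<in> E. 2 ^ i \<le> norm x \<and> norm x < 2 ^ (i + 1)}" for i :: nat
  define ann where "ann i = {y :: real ^ 'd. 2 ^ i < norm y \<and> norm y < 2 ^ (i + 3)}" for i :: nat
  \<comment> \<open>The powers of \<open>\<rho> = 2\<^sup>j\<^sup>+\<^sup>1\<close> from the capacity, the threshold and the weight \<open>1 + \<bar>y\<bar>\<^sup>N\<close> on the
    annulus cancel, and \<open>K\<close> is what is left.\<close>
  define K :: real where "K = 2 * 2 ^ n * 8 ^ N"
  have cap: "ennreal (1 / 2 ^ (Suc j * n)) * boundary_capacity (shell (Suc j)) (ann (Suc j)) \<le>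
      ennreal (K * (a j / \<epsilon> j))" for j
  proof -
    define \<rho> :: real where "\<rho> = 2 ^ Suc j"
    define \<delta> where "\<delta> = \<epsilon> j * \<rho> ^ m"
    have \<rho>: "0 < \<rho>" by (simp add: \<rho>_def)
    have \<delta>: "0 < \<delta>" using \<epsilon>0 \<rho> by (simp add: \<delta>_def)
    have thick: "thick_annulus j = {y :: real ^ 'd. \<rho> / 2 < norm y \<and> norm y < 8 * \<rho>}"
      by (simp add: thick_annulus_def \<rho>_def power_add mult.commute)
    have ann: "ann (Suc j) = {y. \<rho> < norm y \<and> norm y < 8 * \<rho>}"
      by (simp add: ann_def \<rho>_def power_add)
    have big: "ennreal \<delta> \<le> J j x" if "x \<in> shell (Suc j)" for x
    proof -
      have x: "\<rho> \<le> norm x" "ennreal (\<epsilon> j * norm x ^ m) \<le> J j x"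
        using that by (auto simp: shell_def E_def \<rho>_def)
      have "\<delta> \<le> \<epsilon> j * norm x ^ m"
        unfolding \<delta>_def using x(1) \<rho> \<epsilon>0[of j] by (intro mult_left_mono power_mono) auto
      with x(2) show ?thesis by (meson ennreal_leI order_trans)
    qed
    have "boundary_capacity (shell (Suc j)) (ann (Suc j)) \<le>
        ennreal (2 ^ n / \<delta>) * (\<integral>\<^sup>+y. ennreal (u y) * indicator (thick_annulus j) y \<partial>lborel)"
      unfolding ann thick
    proof (rule boundary_capacity_le[OF _ \<rho> \<delta> n])
      show "0 < snd x \<and> \<rho> \<le> norm x" if "x \<in> shell (Suc j)" for x
        using that by (auto simp: shell_def E_def half_space_def \<rho>_def)
    qed (use big in \<open>simp_all add: J_def thick\<close>)
    also have "(\<integral>\<^sup>+y. ennreal (u y) * indicator (thick_annulus j) y \<partial>lborel) \<le>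
        (\<integral>\<^sup>+y. ennreal (2 * (8 * \<rho>) ^ N * (h y * indicator (thick_annulus j) y)) \<partial>lborel)"
    proof (rule nn_integral_mono)
      fix y :: "real ^ 'd"
      have "u y \<le> 2 * (8 * \<rho>) ^ N * h y" if "y \<in> thick_annulus j"
      proof -
        have "norm y ^ N \<le> (8 * \<rho>) ^ N"
          using that by (intro power_mono) (auto simp: thick)
        moreover have "1 \<le> (8 * \<rho>) ^ N"
          using one_le_power[of "2::real" "Suc j"] by (intro one_le_power) (simp add: \<rho>_def)
        ultimately have "1 + norm y ^ N \<le> 2 * (8 * \<rho>) ^ N" by linarith
        then have "h y * (1 + norm y ^ N) \<le> h y * (2 * (8 * \<rho>) ^ N)"
          by (intro mult_left_mono h0)
        moreover have "0 < 1 + norm y ^ N" by (simp add: add_pos_nonneg)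
        then have "h y * (1 + norm y ^ N) = u y" by (simp add: hN)
        ultimately show ?thesis by (simp add: mult_ac)
      qed
      then show "ennreal (u y) * indicator (thick_annulus j) y \<le>
          ennreal (2 * (8 * \<rho>) ^ N * (h y * indicator (thick_annulus j) y))"
        by (auto simp: indicator_def intro: ennreal_leI)
    qed
    also have "\<dots> = ennreal (2 * (8 * \<rho>) ^ N * a j)"
    proof -
      have "(\<integral>\<^sup>+y. ennreal (2 * (8 * \<rho>) ^ N * (h y * indicator (thick_annulus j) y)) \<partial>lborel) =
          ennreal (\<integral>y. 2 * (8 * \<rho>) ^ N * (h y * indicator (thick_annulus j) y) \<partial>lborel)"
        using h0 \<rho> by (intro nn_integral_eq_integral integrable_mult_right thick_int AE_I2) auto
      then show ?thesis by (simp add: a_def)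
    qed
    finally have "boundary_capacity (shell (Suc j)) (ann (Suc j)) \<le>
        ennreal (2 ^ n / \<delta>) * ennreal (2 * (8 * \<rho>) ^ N * a j)" by (simp add: mult_left_mono)
    then have "ennreal (1 / 2 ^ (Suc j * n)) * boundary_capacity (shell (Suc j)) (ann (Suc j)) \<le>
        ennreal (1 / 2 ^ (Suc j * n)) * (ennreal (2 ^ n / \<delta>) * ennreal (2 * (8 * \<rho>) ^ N * a j))"
      by (rule mult_left_mono) simp
    also have "\<dots> = ennreal (1 / 2 ^ (Suc j * n) * (2 ^ n / \<delta> * (2 * (8 * \<rho>) ^ N * a j)))"
    proof -
      have "0 \<le> 1 / (2::real) ^ (Suc j * n)" "0 \<le> 2 ^ n / \<delta>" "0 \<le> 2 * (8 * \<rho>) ^ N * a j"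
        using \<delta> \<rho> a0[of j] by simp_all
      then show ?thesis by (simp only: ennreal_mult[symmetric] mult_nonneg_nonneg)
    qed
    also have "1 / 2 ^ (Suc j * n) * (2 ^ n / \<delta> * (2 * (8 * \<rho>) ^ N * a j)) = K * (a j / \<epsilon> j)"
    proof -
      have "(2::real) ^ (Suc j * n) = \<rho> ^ n" unfolding \<rho>_def by (rule power_mult)
      then show ?thesis
        using \<rho> \<epsilon>0[of j] by (simp add: \<delta>_def K_def N_def power_add power_mult_distrib)
    qed
    finally show ?thesis .
  qed
  have "(\<Sum>j. ennreal (1 / 2 ^ (Suc j * n)) * boundary_capacity (shell (Suc j)) (ann (Suc j))) \<le>
      (\<Sum>j. ennreal (K * (a j / \<epsilon> j)))"
    by (intro suminf_le cap) auto
  also have "\<dots> < \<infinity>"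
  proof -
    have "0 \<le> K * (a j / \<epsilon> j)" for j
      using a0[of j] \<epsilon>0[of j] by (simp add: K_def)
    then show ?thesis
      using summable_mult[OF summ, of K] by (simp add: ennreal_suminf_neq_top less_top)
  qed
  finally have "minimally_thin_at_infinity E"
    by (simp only: minimally_thin_at_infinity_def Let_def shell_def ann_def n)
  moreover have "\<exists>j. 2 ^ (j + 1) \<le> norm x \<and> norm x < 2 ^ (j + 2) \<and> J j x \<le> ennreal (\<epsilon> j * norm x ^ m)"
    if "x \<in> half_space - E" for x
    using that by (auto simp: E_def not_le intro: less_imp_le)
  ultimately show thesis
    using that[of \<epsilon> E] \<epsilon>0 \<epsilon>_lim by (auto simp: E_def J_def)
qed

section \<open>Growth of the modified Poisson integral\<close>

text \<open>
  The kernel estimate integrated against \<open>f\<close>: the potential of the annulus is small by hypothesis,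
  and everything else is absorbed in the cutoff integral.
\<close>

lemma modified_poisson_integral_bound:
  fixes f u :: "real ^ 'd::finite \<Rightarrow> real" and n m j :: nat and x :: "'d point"
  defines "h \<equiv> \<lambda>y. u y / (1 + norm y ^ (n + m))"
  assumes n: "n = CARD('d) + 1" and u [measurable]: "u \<in> borel_measurable lborel"
    and u0: "\<And>y. 0 \<le> u y" and h: "integrable lborel h"
    and fu: "AE y in lebesgue. \<bar>f y\<bar> = u y"
    and C: "0 \<le> C" and \<epsilon>: "0 \<le> \<epsilon>" and x: "0 < snd x"
    and ker: "\<And>y. \<bar>modified_poisson_kernel m x y\<bar> \<le> 2 * snd x / sphere_area n *
         (indicator (thick_annulus j) y / norm (x - (y, 0)) ^ n +
          C * norm x ^ m * (cutoff j y / (1 + norm y ^ (n + m))))"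
    and near: "(\<integral>\<^sup>+y. ennreal (u y) * indicator (thick_annulus j) y * ennreal (1 / norm (x - (y, 0)) ^ n) \<partial>lborel)
         \<le> ennreal (\<epsilon> * norm x ^ m)"
  shows "\<bar>\<integral>y. modified_poisson_kernel m x y * f y \<partial>lebesgue\<bar> / (snd x * norm x ^ m) \<le>
     2 / sphere_area n * (\<epsilon> + C * (\<integral>y. h y * cutoff j y \<partial>lborel))"
proof -
  define c where "c = 2 * snd x / sphere_area n"
  have c: "0 < c" using x sphere_area_pos[of n] n by (simp add: c_def)
  define R where "R = norm x ^ m"
  have "x \<noteq> 0" using x by auto
  then have R: "0 < R" by (simp add: R_def)
  define \<Phi> where "\<Phi> = (\<integral>y. h y * cutoff j y \<partial>lborel)"
  have h0: "0 \<le> h y" for y using u0 by (simp add: h_def)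
  have cut_meas [measurable]: "cutoff i \<in> borel_measurable (borel :: (real ^ 'd) measure)" for i
    unfolding cutoff_def by measurable
  have [measurable]: "thick_annulus j \<in> sets (borel :: (real ^ 'd) measure)"
    unfolding thick_annulus_def by measurable
  have [measurable]: "h \<in> borel_measurable lborel" using h by auto
  have [measurable]: "(\<lambda>y. norm (x - (y, 0))) \<in> borel_measurable borel"
    by (intro borel_measurable_continuous_onI continuous_intros)
  have int: "integrable lborel (\<lambda>y. h y * cutoff j y)"
    by (rule integral_vanishing_weight(2)[OF h])
       (auto simp: cutoff_nonneg cutoff_le_1 cutoff_tendsto_0)
  have \<Phi>0: "0 \<le> \<Phi>" unfolding \<Phi>_def
    by (intro Bochner_Integration.integral_nonneg mult_nonneg_nonneg h0 cutoff_nonneg)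
  have "ennreal \<bar>\<integral>y. modified_poisson_kernel m x y * f y \<partial>lebesgue\<bar> \<le>
      (\<integral>\<^sup>+y. ennreal \<bar>modified_poisson_kernel m x y * f y\<bar> \<partial>lebesgue)"
    by (rule abs_integral_le_nn_integral)
  also have "\<dots> \<le> (\<integral>\<^sup>+y. ennreal (c * (u y * indicator (thick_annulus j) y * (1 / norm (x - (y, 0)) ^ n))
      + c * (C * R) * (h y * cutoff j y)) \<partial>lebesgue)"
  proof (rule nn_integral_mono_AE)
    show "AE y in lebesgue. ennreal \<bar>modified_poisson_kernel m x y * f y\<bar> \<le>
      ennreal (c * (u y * indicator (thick_annulus j) y * (1 / norm (x - (y, 0)) ^ n))
      + c * (C * R) * (h y * cutoff j y))"
      using fu
    proof eventually_elim
      case (elim y)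
      have "\<bar>modified_poisson_kernel m x y * f y\<bar> \<le> c * (indicator (thick_annulus j) y / norm (x - (y, 0)) ^ n +
          C * R * (cutoff j y / (1 + norm y ^ (n + m)))) * u y"
        unfolding abs_mult elim c_def R_def by (intro mult_right_mono ker u0)
      also have "\<dots> = c * (u y * indicator (thick_annulus j) y * (1 / norm (x - (y, 0)) ^ n))
          + c * (C * R) * (h y * cutoff j y)"
        by (simp add: h_def algebra_simps)
      finally show ?case by (rule ennreal_leI)
    qed
  qed
  also have "\<dots> = (\<integral>\<^sup>+y. ennreal c * (ennreal (u y) * indicator (thick_annulus j) y * ennreal (1 / norm (x - (y, 0)) ^ n))
      + ennreal (c * (C * R)) * ennreal (h y * cutoff j y) \<partial>lborel)"
    unfolding nn_integral_completion
  proof (rule nn_integral_cong)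
    fix y
    have nonneg: "0 \<le> c" "0 \<le> u y" "0 \<le> c * (C * R)" "0 \<le> h y * cutoff j y"
      using c u0 R by (simp_all add: C h0 cutoff_nonneg)
    have eq: "ennreal (c * (u y * q) + c * (C * R) * (h y * cutoff j y)) =
        ennreal c * (ennreal (u y) * ennreal q) + ennreal (c * (C * R)) * ennreal (h y * cutoff j y)"
      if "0 \<le> q" for q
      using that nonneg by (simp only: ennreal_plus ennreal_mult mult_nonneg_nonneg)
    have ind: "ennreal (indicator (thick_annulus j) y * (1 / norm (x - (y, 0)) ^ n)) =
        indicator (thick_annulus j) y * ennreal (1 / norm (x - (y, 0)) ^ n)"
      by (simp add: indicator_def)
    have q0: "0 \<le> indicator (thick_annulus j) y * (1 / norm (x - (y, 0)) ^ n)" by simp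
    show "ennreal (c * (u y * indicator (thick_annulus j) y * (1 / norm (x - (y, 0)) ^ n))
        + c * (C * R) * (h y * cutoff j y)) =
      ennreal c * (ennreal (u y) * indicator (thick_annulus j) y * ennreal (1 / norm (x - (y, 0)) ^ n))
        + ennreal (c * (C * R)) * ennreal (h y * cutoff j y)"
      using eq[OF q0] unfolding ind by (simp only: mult.assoc)
  qed
  also have "\<dots> = ennreal c * (\<integral>\<^sup>+y. ennreal (u y) * indicator (thick_annulus j) y * ennreal (1 / norm (x - (y, 0)) ^ n) \<partial>lborel)
      + ennreal (c * (C * R)) * (\<integral>\<^sup>+y. ennreal (h y * cutoff j y) \<partial>lborel)"
    by (simp add: nn_integral_add nn_integral_cmult)
  also have "(\<integral>\<^sup>+y. ennreal (h y * cutoff j y) \<partial>lborel) = ennreal \<Phi>"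
    unfolding \<Phi>_def
    by (intro nn_integral_eq_integral int AE_I2 mult_nonneg_nonneg h0 cutoff_nonneg)
  also have "ennreal c * (\<integral>\<^sup>+y. ennreal (u y) * indicator (thick_annulus j) y * ennreal (1 / norm (x - (y, 0)) ^ n) \<partial>lborel)
      + ennreal (c * (C * R)) * ennreal \<Phi> \<le> ennreal c * ennreal (\<epsilon> * R) + ennreal (c * (C * R)) * ennreal \<Phi>"
    unfolding R_def by (intro add_right_mono mult_left_mono near) simp
  also have "\<dots> = ennreal (c * (\<epsilon> * R) + c * (C * R) * \<Phi>)"
  proof -
    have "0 \<le> c" "0 \<le> \<epsilon> * R" "0 \<le> c * (C * R)" "0 \<le> c * (\<epsilon> * R)" "0 \<le> c * (C * R) * \<Phi>"
      using c R \<epsilon> C \<Phi>0 by auto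
    then show ?thesis using \<Phi>0 by (simp only: ennreal_plus ennreal_mult)
  qed
  finally have "\<bar>\<integral>y. modified_poisson_kernel m x y * f y \<partial>lebesgue\<bar> \<le> c * (\<epsilon> * R) + c * (C * R) * \<Phi>"
    using c R \<epsilon> C \<Phi>0 by (subst (asm) ennreal_le_iff) auto
  also have "\<dots> = 2 / sphere_area n * (\<epsilon> + C * \<Phi>) * (snd x * R)"
    by (simp add: c_def algebra_simps add_divide_distrib)
  finally show ?thesis
    using x R by (simp add: R_def[symmetric] \<Phi>_def[symmetric] pos_divide_le_eq)
qed

theorem theorem3:
  fixes f :: "real ^ 'd \<Rightarrow> real" and v :: "('d::finite) point \<Rightarrow> real" and n m :: nat
  assumes "n = CARD('d) + 1" and "n \<ge> 3"
    and "f \<in> borel_measurable lebesgue"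
    and "(\<integral>\<^sup>+ y. ennreal (\<bar>f y\<bar> / (1 + norm y ^ (n + m))) \<partial>lebesgue) < \<infinity>"
    and "\<And>x. x \<in> half_space \<Longrightarrow>
           v x = (\<integral> y. modified_poisson_kernel m x y * f y \<partial>lebesgue)"
  shows "\<exists>E. E \<subseteq> half_space \<and> minimally_thin_at_infinity E \<and>
           ((\<lambda>x. v x / (snd x * norm x ^ m)) \<longlongrightarrow> 0)
             (inf at_infinity (principal (half_space - E)))"
proof -
  note n = assms(1) and v = assms(5)
  \<comment> \<open>A Borel representative of \<open>f\<close> is needed for the image measure under the inversion.\<close>
  obtain f' where f' [measurable]: "f' \<in> borel_measurable lborel" and ff': "AE y in lborel. f y = f' y"
    using completion_ex_borel_measurable_real[OF assms(3)] by blast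
  define u where "u y = \<bar>f' y\<bar>" for y
  have u [measurable]: "u \<in> borel_measurable lborel" unfolding u_def by measurable
  have u0: "0 \<le> u y" for y by (simp add: u_def)
  have fu: "AE y in lebesgue. \<bar>f y\<bar> = u y"
    using AE_completion[OF ff'] by eventually_elim (simp add: u_def)
  define h where "h y = u y / (1 + norm y ^ (n + m))" for y
  have h: "integrable lborel h"
  proof (rule integrableI_nonneg)
    show "h \<in> borel_measurable lborel" unfolding h_def by measurable
    show "AE y in lborel. 0 \<le> h y" using u0 by (simp add: h_def)
    have "(\<integral>\<^sup>+y. ennreal (h y) \<partial>lborel) = (\<integral>\<^sup>+y. ennreal (h y) \<partial>lebesgue)"
      by (simp add: nn_integral_completion)
    also have "\<dots> = (\<integral>\<^sup>+ y. ennreal (\<bar>f y\<bar> / (1 + norm y ^ (n + m))) \<partial>lebesgue)"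
      by (rule nn_integral_cong_AE) (use fu in eventually_elim, simp add: h_def)
    finally show "(\<integral>\<^sup>+y. ennreal (h y) \<partial>lborel) < \<infinity>" using assms(4) by simp
  qed
  obtain \<epsilon> E where \<epsilon>: "\<epsilon> \<longlonglongrightarrow> 0" "\<And>j. 0 < \<epsilon> j" and E: "E \<subseteq> (half_space :: 'd point set)" "minimally_thin_at_infinity E"
    and good: "\<And>x. x \<in> half_space - E \<Longrightarrow> \<exists>j. 2 ^ (j + 1) \<le> norm x \<and> norm x < 2 ^ (j + 2) \<and>
       (\<integral>\<^sup>+y. ennreal (u y) * indicator (thick_annulus j) y * ennreal (1 / norm (x - (y, 0)) ^ n) \<partial>lborel)
         \<le> ennreal (\<epsilon> j * norm x ^ m)"
    using thin_exceptional_set[OF n u u0 h[unfolded h_def]] by blast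
  obtain C where C: "0 \<le> C" and ker:
    "\<And>(x :: 'd point) y j. 0 < snd x \<Longrightarrow> 2 ^ (j + 1) \<le> norm x \<Longrightarrow> norm x < 2 ^ (j + 2) \<Longrightarrow>
       \<bar>modified_poisson_kernel m x y\<bar> \<le> 2 * snd x / sphere_area n *
         (indicator (thick_annulus j) y / norm (x - (y, 0)) ^ n +
          C * norm x ^ m * (cutoff j y / (1 + norm y ^ (n + m))))"
    unfolding n by (rule modified_poisson_kernel_bound[where m = m and 'd = 'd]) (rule that[unfolded n]; assumption)
  define \<beta> where "\<beta> j = 2 / sphere_area n * (\<epsilon> j + C * (\<integral>y. h y * cutoff j y \<partial>lborel))" for j
  have cut_meas: "cutoff j \<in> borel_measurable (lborel :: (real ^ 'd) measure)" for j
    unfolding cutoff_def by measurable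
  have "(\<lambda>j. \<integral>y. h y * cutoff j y \<partial>lborel) \<longlonglongrightarrow> 0"
    by (rule integral_vanishing_weight(1)[OF h cut_meas])
       (auto simp: cutoff_nonneg cutoff_le_1 cutoff_tendsto_0)
  from tendsto_mult[OF tendsto_const[of "2 / sphere_area n"]
      tendsto_add[OF \<epsilon>(1) tendsto_mult[OF tendsto_const[of C] this]]]
  have \<beta>: "\<beta> \<longlonglongrightarrow> 0"
    unfolding \<beta>_def by simp
  have bound: "\<exists>j. norm x < 2 ^ (j + 2) \<and> \<bar>v x / (snd x * norm x ^ m)\<bar> \<le> \<beta> j"
    if x_good: "x \<in> half_space - E" for x
  proof -
    obtain j where j: "2 ^ (j + 1) \<le> norm x" "norm x < 2 ^ (j + 2)" and
      near: "(\<integral>\<^sup>+y. ennreal (u y) * indicator (thick_annulus j) y * ennreal (1 / norm (x - (y, 0)) ^ n) \<partial>lborel)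
         \<le> ennreal (\<epsilon> j * norm x ^ m)"
      using good[OF x_good] by blast
    have x: "0 < snd x" "x \<in> half_space" using x_good by (auto simp: half_space_def)
    from modified_poisson_integral_bound[OF n u u0 h[unfolded h_def] fu C less_imp_le[OF \<epsilon>(2)] x(1)
        ker[OF x(1) j] near]
    have "\<bar>v x\<bar> / (snd x * norm x ^ m) \<le> \<beta> j"
      by (simp add: \<beta>_def h_def v[OF x(2)])
    then show ?thesis using j(2) x(1) by (auto simp: abs_divide abs_mult)
  qed
  have "((\<lambda>x. v x / (snd x * norm x ^ m)) \<longlongrightarrow> 0) (inf at_infinity (principal (half_space - E)))"
  proof (rule tendstoI)
    fix e :: real assume "0 < e"
    with \<beta> have "\<forall>\<^sub>F j in sequentially. \<beta> j < e" by (rule order_tendstoD)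
    then obtain k where k: "\<And>j. k \<le> j \<Longrightarrow> \<beta> j < e"
      unfolding eventually_sequentially by blast
    have "dist (v x / (snd x * norm x ^ m)) 0 < e"
      if x: "2 ^ (k + 2) \<le> norm x" "x \<in> half_space - E" for x
    proof -
      obtain j where j: "norm x < 2 ^ (j + 2)" "\<bar>v x / (snd x * norm x ^ m)\<bar> \<le> \<beta> j"
        using bound[OF x(2)] by blast
      have "(2::real) ^ (k + 2) < 2 ^ (j + 2)" using x(1) j(1) by linarith
      then have "k \<le> j" by (simp add: power_strict_increasing_iff)
      from k[OF this] j(2) show ?thesis by simp
    qed
    then show "\<forall>\<^sub>F x in inf at_infinity (principal (half_space - E)).
        dist (v x / (snd x * norm x ^ m)) 0 < e"
      unfolding eventually_inf_principal eventually_at_infinity by blast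
  qed
  with E show ?thesis by blast
qed

end
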